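(* Let $\omega$ be a clustering state. There exists a bijection $\widehat{\mathfrak D}:\widehat{\mathcal Q}_\omega\to\widehat{\mathcal H}_\omega$ such that for every $\widehat Q_\omega\in\widehat{\mathcal Q}_\omega$ and every $A\in\mathcal O$, $$\widehat Q_\omega(A)=\langle\langle\widehat{\mathfrak D}(\widehat Q_\omega),A\rangle\rangle_\omega.$$ In particular, every $\widehat Q_\omega$ extends to a continuous linear functional on $\widehat{\mathcal H}_\omega$.
   Context: Setting: Fix $D\ge1$, $\mathbb Z^D$ with $\mathrm{dist}(x,y)=\sum_i|x_i-y_i|$, $\mathtt B(n)=\{x:\mathrm{dist}(x,0)\le n\}$. $\mathcal O$ is a complex normed space with distinguished $\mathbf 1$ of norm 1, finite-dimensional subspaces $\mathcal O_X$ ($X$ finite) with $\mathcal O_\emptyset=\mathbb C\mathbf 1$, $X\subset Y\Rightarrow\mathcal O_X\subset\mathcal O_Y$, $\mathcal O_X\cap\mathcal O_Y=\mathcal O_{X\cap Y}$, $\mathcal O=\bigcup_X\mathcal O_X$; $\mathrm{supp}(A)$ smallest $X$ with $A\in\mathcal O_X$, $|A|=|\mathrm{supp}A|$, $\mathrm{dist}(A,B)$ distance of supports ($\mathrm{dist}(A,\mathbf 1)=\infty$). Completion $\mathcal A$ is a unital $C^*$-algebra, $\mathcal O_X$ are $C^*$-subalgebras, disjointly supported elements commute with union support of the product; translations $\iota_x$ are $*$-automorphisms, $\iota_x\iota_y=\iota_{x+y}$, $\mathrm{supp}(\iota_xA)=\mathrm{supp}(A)+x$. Clustering state: translation-invariant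 state $\omega$ with $\nu:\mathbb N\to\mathbb R^+$, $f:\mathbb Z\to\mathbb R^+$, $p>D$, $f(d)\le d^{-p}$ ($d>0$), $|\omega(AB)-\omega(A)\omega(B)|\le\nu(\ell)\|A\|\|B\|f(\mathrm{dist}(A,B))$ for $|A|,|B|<\ell$. $\langle\langle A,B\rangle\rangle_\omega:=\sum_{x\in\mathbb Z^D}\big(\tfrac12\omega(\{\iota_x(A)^*,B\})-\omega(A^* )\omega(B)\big)$ ($\{\cdot,\cdot\}$ the anticommutator), a positive semi-definite sesquilinear form; $\widehat{\mathcal H}_\omega$ is the Cauchy completion of $\mathcal O$ modulo its null space (elements of $\mathcal O$ identified with classes). Pseudolocal sequence $Q=(Q_n)$, $Q_n\in\mathcal O_{\mathtt B(n)}$: $Q'_n:=Q_n-\omega(Q_n)\mathbf 1$ satisfies (I) $\omega(Q_n'^*Q'_n)\le\gamma n^D$ for some $\gamma>0$, all $n>0$; (II) $\lim_n\omega(Q_n'^*A)$ exists for all $A\in\mathcal O$; (III) for some $0<k<1$, $\lim_n\max_{x,y\in\mathtt B(kn)}|\omega(Q_n'^*\iota_xA)-\omega(Q_n'^*\iota_yA)|=0$ for all $A$. If both $Q$ and $Q^*=(Q_n^* )$ are pseudolocal, the two-sided pseudolocal charge of $Q$ is the functional $\widehat Q_\omega(A):=\lim_{n\to\infty}\big(\tfrac12\omega(\{Q_n^*,A\})-\omega(Q_n^* )\omega(A)\big)$ on $\mathcal O$; $\widehat{\mathcal Q}_\omega$ is the set of all such functionals. *)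

theory Defs
  imports "HOL-Analysis.Analysis"
begin

text \<open>Z^D is modelled as int^'d for a finite index type 'd; D = CARD('d).\<close>

definition ldist :: "int^'d \<Rightarrow> int^'d \<Rightarrow> int" where
  "ldist x y = (\<Sum>i\<in>UNIV. \<bar>x$i - y$i\<bar>)"

definition lball :: "real \<Rightarrow> (int^'d) set" where
  "lball r = {x. real_of_int (ldist x 0) \<le> r}"

text \<open>The ambient type 'a is a real Banach algebra with unit of norm 1; complex
  scalar multiplication is multiplication by the central element (Re c + Im c * ii).\<close>

definition cscale :: "'a::real_normed_algebra_1 \<Rightarrow> complex \<Rightarrow> 'a \<Rightarrow> 'a" where
  "cscale ii c a = (of_real (Re c) + of_real (Im c) * ii) * a"

definition unital_cstar_algebra :: "('a::{real_normed_algebra_1,banach} \<Rightarrow> 'a) \<Rightarrow> 'a \<Rightarrow> bool" where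
  "unital_cstar_algebra star ii \<longleftrightarrow>
     (\<forall>a. ii * a = a * ii) \<and> ii * ii = - 1 \<and>
     (\<forall>c a. norm (cscale ii c a) = cmod c * norm a) \<and>
     (\<forall>a b. star (a + b) = star a + star b) \<and>
     (\<forall>c a. star (cscale ii c a) = cscale ii (cnj c) (star a)) \<and>
     (\<forall>a b. star (a * b) = star b * star a) \<and>
     (\<forall>a. star (star a) = a) \<and>
     (\<forall>a. norm (star a * a) = (norm a)\<^sup>2)"

definition cspan_fin :: "'a::real_normed_algebra_1 \<Rightarrow> 'a set \<Rightarrow> 'a set" where
  "cspan_fin ii S = {\<Sum>s\<in>S. cscale ii (c s) s | c. True}"

definition cstar_subalg :: "('a::{real_normed_algebra_1,banach} \<Rightarrow> 'a) \<Rightarrow> 'a \<Rightarrow> 'a set \<Rightarrow> bool" where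
  "cstar_subalg star ii S \<longleftrightarrow>
     0 \<in> S \<and> 1 \<in> S \<and>
     (\<forall>a\<in>S. \<forall>b\<in>S. a + b \<in> S \<and> a * b \<in> S) \<and>
     (\<forall>c. \<forall>a\<in>S. cscale ii c a \<in> S) \<and>
     (\<forall>a\<in>S. star a \<in> S)"

definition Obs :: "((int^'d) set \<Rightarrow> 'a set) \<Rightarrow> 'a set" where
  "Obs Oloc = (\<Union>X\<in>{X. finite X}. Oloc X)"

definition supp :: "((int^'d) set \<Rightarrow> 'a set) \<Rightarrow> 'a \<Rightarrow> (int^'d) set" where
  "supp Oloc a = \<Inter>{X. finite X \<and> a \<in> Oloc X}"

text \<open>Distance of supports (only used for nonempty supports).\<close>
definition sdist :: "((int^'d) set \<Rightarrow> 'a set) \<Rightarrow> 'a \<Rightarrow> 'a \<Rightarrow> int" where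
  "sdist Oloc a b = Min {ldist x y | x y. x \<in> supp Oloc a \<and> y \<in> supp Oloc b}"

definition quasilocal_setup ::
  "('a::{real_normed_algebra_1,banach} \<Rightarrow> 'a) \<Rightarrow> 'a \<Rightarrow> ((int^'d) set \<Rightarrow> 'a set)
    \<Rightarrow> (int^'d \<Rightarrow> 'a \<Rightarrow> 'a) \<Rightarrow> bool" where
  "quasilocal_setup star ii Oloc iota \<longleftrightarrow>
     unital_cstar_algebra star ii \<and>
     \<comment> \<open>local algebras: finite-dimensional C*-subalgebras\<close>
     (\<forall>X. finite X \<longrightarrow> cstar_subalg star ii (Oloc X) \<and>
                         (\<exists>S. finite S \<and> S \<subseteq> Oloc X \<and> Oloc X = cspan_fin ii S)) \<and>
     Oloc {} = {cscale ii c 1 | c. True} \<and>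
     (\<forall>X Y. finite X \<longrightarrow> finite Y \<longrightarrow> X \<subseteq> Y \<longrightarrow> Oloc X \<subseteq> Oloc Y) \<and>
     (\<forall>X Y. finite X \<longrightarrow> finite Y \<longrightarrow> Oloc X \<inter> Oloc Y = Oloc (X \<inter> Y)) \<and>
     \<comment> \<open>A is the completion of O\<close>
     closure (Obs Oloc) = UNIV \<and>
     \<comment> \<open>disjointly supported elements commute\<close>
     (\<forall>X Y. finite X \<longrightarrow> finite Y \<longrightarrow> X \<inter> Y = {} \<longrightarrow>
        (\<forall>a\<in>Oloc X. \<forall>b\<in>Oloc Y. a * b = b * a)) \<and>
     \<comment> \<open>translations: *-automorphisms forming a representation of Z^D\<close>
     (\<forall>x. bij (iota x)) \<and>
     (\<forall>x a b. iota x (a + b) = iota x a + iota x b) \<and>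
     (\<forall>x c a. iota x (cscale ii c a) = cscale ii c (iota x a)) \<and>
     (\<forall>x a b. iota x (a * b) = iota x a * iota x b) \<and>
     (\<forall>x. iota x 1 = 1) \<and>
     (\<forall>x a. iota x (star a) = star (iota x a)) \<and>
     (\<forall>x y a. iota x (iota y a) = iota (x + y) a) \<and>
     (\<forall>x. \<forall>a\<in>Obs Oloc. iota x a \<in> Obs Oloc \<and>
            supp Oloc (iota x a) = (\<lambda>y. y + x) ` supp Oloc a)"

definition trans_inv_state ::
  "('a::{real_normed_algebra_1,banach} \<Rightarrow> 'a) \<Rightarrow> 'a \<Rightarrow> (int^'d \<Rightarrow> 'a \<Rightarrow> 'a)
    \<Rightarrow> ('a \<Rightarrow> complex) \<Rightarrow> bool" where
  "trans_inv_state star ii iota \<omega> \<longleftrightarrow>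
     (\<forall>a b. \<omega> (a + b) = \<omega> a + \<omega> b) \<and>
     (\<forall>c a. \<omega> (cscale ii c a) = c * \<omega> a) \<and>
     (\<forall>a. Im (\<omega> (star a * a)) = 0 \<and> Re (\<omega> (star a * a)) \<ge> 0) \<and>
     \<omega> 1 = 1 \<and>
     (\<forall>x a. \<omega> (iota x a) = \<omega> a)"

definition clustering_state ::
  "('a::{real_normed_algebra_1,banach} \<Rightarrow> 'a) \<Rightarrow> 'a \<Rightarrow> ((int^'d) set \<Rightarrow> 'a set)
    \<Rightarrow> (int^'d \<Rightarrow> 'a \<Rightarrow> 'a) \<Rightarrow> ('a \<Rightarrow> complex) \<Rightarrow> bool" where
  "clustering_state star ii Oloc iota \<omega> \<longleftrightarrow>
     quasilocal_setup star ii Oloc iota \<and> trans_inv_state star ii iota \<omega> \<and>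
     (\<exists>(\<nu>::nat \<Rightarrow> real) (f::int \<Rightarrow> real) (p::real).
        (\<forall>l. \<nu> l \<ge> 0) \<and> (\<forall>d. f d \<ge> 0) \<and> p > real CARD('d) \<and>
        (\<forall>d>0. f d \<le> real_of_int d powr (- p)) \<and>
        (\<forall>l. \<forall>a\<in>Obs Oloc. \<forall>b\<in>Obs Oloc.
            supp Oloc a \<noteq> {} \<longrightarrow> supp Oloc b \<noteq> {} \<longrightarrow>
            card (supp Oloc a) < l \<longrightarrow> card (supp Oloc b) < l \<longrightarrow>
            cmod (\<omega> (a * b) - \<omega> a * \<omega> b)
              \<le> \<nu> l * norm a * norm b * f (sdist Oloc a b)))"

definition hform ::
  "('a::{real_normed_algebra_1,banach} \<Rightarrow> 'a) \<Rightarrow> (int^'d \<Rightarrow> 'a \<Rightarrow> 'a)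
    \<Rightarrow> ('a \<Rightarrow> complex) \<Rightarrow> 'a \<Rightarrow> 'a \<Rightarrow> complex" where
  "hform star iota \<omega> a b =
     infsum (\<lambda>x. \<omega> (star (iota x a) * b + b * star (iota x a)) / 2 - \<omega> (star a) * \<omega> b) UNIV"

definition hsn :: "('a::{real_normed_algebra_1,banach} \<Rightarrow> 'a) \<Rightarrow> (int^'d \<Rightarrow> 'a \<Rightarrow> 'a)
    \<Rightarrow> ('a \<Rightarrow> complex) \<Rightarrow> 'a \<Rightarrow> real" where
  "hsn star iota \<omega> a = sqrt (Re (hform star iota \<omega> a a))"

definition hcauchy :: "('a::{real_normed_algebra_1,banach} \<Rightarrow> 'a) \<Rightarrow> ((int^'d) set \<Rightarrow> 'a set)
    \<Rightarrow> (int^'d \<Rightarrow> 'a \<Rightarrow> 'a) \<Rightarrow> ('a \<Rightarrow> complex) \<Rightarrow> (nat \<Rightarrow> 'a) \<Rightarrow> bool" where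
  "hcauchy star Oloc iota \<omega> s \<longleftrightarrow>
     (\<forall>n. s n \<in> Obs Oloc) \<and>
     (\<forall>e>0. \<exists>N. \<forall>m\<ge>N. \<forall>n\<ge>N. hsn star iota \<omega> (s m - s n) < e)"

definition hequiv :: "('a::{real_normed_algebra_1,banach} \<Rightarrow> 'a) \<Rightarrow> (int^'d \<Rightarrow> 'a \<Rightarrow> 'a)
    \<Rightarrow> ('a \<Rightarrow> complex) \<Rightarrow> (nat \<Rightarrow> 'a) \<Rightarrow> (nat \<Rightarrow> 'a) \<Rightarrow> bool" where
  "hequiv star iota \<omega> s t \<longleftrightarrow> (\<lambda>n. hsn star iota \<omega> (s n - t n)) \<longlonglongrightarrow> 0"

text \<open>The Cauchy completion of O modulo the null space: classes of Cauchy sequences.\<close>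
definition Hhat :: "('a::{real_normed_algebra_1,banach} \<Rightarrow> 'a) \<Rightarrow> ((int^'d) set \<Rightarrow> 'a set)
    \<Rightarrow> (int^'d \<Rightarrow> 'a \<Rightarrow> 'a) \<Rightarrow> ('a \<Rightarrow> complex) \<Rightarrow> (nat \<Rightarrow> 'a) set set" where
  "Hhat star Oloc iota \<omega> =
     {{t. hcauchy star Oloc iota \<omega> t \<and> hequiv star iota \<omega> s t} | s. hcauchy star Oloc iota \<omega> s}"

text \<open>The form extended (by continuity in its first argument) to H x O.\<close>
definition hpair :: "('a::{real_normed_algebra_1,banach} \<Rightarrow> 'a) \<Rightarrow> (int^'d \<Rightarrow> 'a \<Rightarrow> 'a)
    \<Rightarrow> ('a \<Rightarrow> complex) \<Rightarrow> (nat \<Rightarrow> 'a) set \<Rightarrow> 'a \<Rightarrow> complex" where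
  "hpair star iota \<omega> h b = lim (\<lambda>n. hform star iota \<omega> ((SOME s. s \<in> h) n) b)"

definition centred :: "'a::real_normed_algebra_1 \<Rightarrow> ('a \<Rightarrow> complex) \<Rightarrow> 'a \<Rightarrow> 'a" where
  "centred ii \<omega> q = q - cscale ii (\<omega> q) 1"

definition pseudolocal ::
  "('a::{real_normed_algebra_1,banach} \<Rightarrow> 'a) \<Rightarrow> 'a \<Rightarrow> ((int^'d) set \<Rightarrow> 'a set)
    \<Rightarrow> (int^'d \<Rightarrow> 'a \<Rightarrow> 'a) \<Rightarrow> ('a \<Rightarrow> complex) \<Rightarrow> (nat \<Rightarrow> 'a) \<Rightarrow> bool" where
  "pseudolocal star ii Oloc iota \<omega> Q \<longleftrightarrow>
     (\<forall>n. Q n \<in> Oloc (lball (real n))) \<and>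
     (\<exists>\<gamma>>0. \<forall>n>0. Re (\<omega> (star (centred ii \<omega> (Q n)) * centred ii \<omega> (Q n)))
                     \<le> \<gamma> * real n ^ CARD('d)) \<and>
     (\<forall>a\<in>Obs Oloc. convergent (\<lambda>n. \<omega> (star (centred ii \<omega> (Q n)) * a))) \<and>
     (\<exists>k. 0 < k \<and> k < 1 \<and>
        (\<forall>a\<in>Obs Oloc.
           (\<lambda>n. Max {cmod (\<omega> (star (centred ii \<omega> (Q n)) * iota x a)
                            - \<omega> (star (centred ii \<omega> (Q n)) * iota y a))
                      | x y. x \<in> lball (k * real n) \<and> y \<in> lball (k * real n)})
           \<longlonglongrightarrow> 0))"

definition qcharge ::
  "('a::{real_normed_algebra_1,banach} \<Rightarrow> 'a) \<Rightarrow> ((int^'d) set \<Rightarrow> 'a set)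
    \<Rightarrow> ('a \<Rightarrow> complex) \<Rightarrow> (nat \<Rightarrow> 'a) \<Rightarrow> 'a \<Rightarrow> complex" where
  "qcharge star Oloc \<omega> Q a =
     (if a \<in> Obs Oloc
      then lim (\<lambda>n. \<omega> (star (Q n) * a + a * star (Q n)) / 2 - \<omega> (star (Q n)) * \<omega> a)
      else 0)"

definition Qhat ::
  "('a::{real_normed_algebra_1,banach} \<Rightarrow> 'a) \<Rightarrow> 'a \<Rightarrow> ((int^'d) set \<Rightarrow> 'a set)
    \<Rightarrow> (int^'d \<Rightarrow> 'a \<Rightarrow> 'a) \<Rightarrow> ('a \<Rightarrow> complex) \<Rightarrow> ('a \<Rightarrow> complex) set" where
  "Qhat star ii Oloc iota \<omega> =
     {qcharge star Oloc \<omega> Q | Q. pseudolocal star ii Oloc iota \<omega> Q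
                               \<and> pseudolocal star ii Oloc iota \<omega> (\<lambda>n. star (Q n))}"

end

theory Submission
  imports Defs
begin

text \<open>With \<open>e(a,b) = \<omega>(a\<^sup>* b) - \<omega>(a\<^sup>*) \<omega>(b)\<close> and \<open>L(a,b) = \<Sum>\<^sub>x e(\<iota>\<^sub>x a, b)\<close>, the form is
  \<open>(L(a,b) + cnj (L(a\<^sup>*,b\<^sup>*))) / 2\<close>, and a two-sided charge decomposes in the same way into the limits
  of \<open>e(Q\<^sub>n,a)\<close> and \<open>e(Q\<^sub>n\<^sup>*,a\<^sup>*)\<close>. Averaging \<open>a\<close> over a cube bounds each limit by the norm of \<open>L\<close>,
  so charges are represented by Cauchy sequences through the Riesz argument. Conversely a Cauchy
  sequence \<open>s\<close> is represented by \<open>Q\<^sub>n = \<Sum>\<^sub>x \<iota>\<^sub>x s\<^sub>m\<close>, summed over a cube of side proportional to \<open>n\<close>, where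
  \<open>m = m(n)\<close> tends to infinity slowly enough for clustering to make boundary effects negligible.\<close>

section \<open>Positive semi-definite forms\<close>

text \<open>Conditions (I)-(III) see only the one-sided covariance \<open>e (Q n) a\<close>, while
  charge and form are symmetrised. Hence the split into two halves: one-sided bounds for
  \<open>Q\<close> and for its adjoint combine, because the squared two-sided norm of
  \<open>a\<close> is the mean of the squared \<open>L\<close>-norms of \<open>a\<close> and
  \<open>star a\<close>. In the converse direction the obstacle is that a Cauchy sequence for this
  norm has no control over supports or operator norms, so clustering rates need not be uniform along
  it. Each \<open>s m\<close> is therefore used only at scales where its correlations with
  observables of radius and norm at most \<open>m\<close> have decayed. Only the
  \<open>L\<close>-norms must stay bounded, and this suffices for (I). Positive semi-definite forms
  are treated abstractly because three of them occur: \<open>e\<close>, \<open>L\<close> and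
  \<open>hform\<close>. They carry seminorms only, and Cauchy sequences take the place of a complete
  space.\<close>

locale psd_form =
  fixes V :: "'v::ab_group_add set"
    and sc :: "complex \<Rightarrow> 'v \<Rightarrow> 'v"
    and B :: "'v \<Rightarrow> 'v \<Rightarrow> complex"
  assumes V_zero: "0 \<in> V"
    and V_add: "a \<in> V \<Longrightarrow> b \<in> V \<Longrightarrow> a + b \<in> V"
    and V_sc: "a \<in> V \<Longrightarrow> sc z a \<in> V"
    and sc_one: "sc 1 a = a"
    and sc_neg: "sc (- 1) a = - a"
    and B_add_right: "\<lbrakk>a \<in> V; b \<in> V; c \<in> V\<rbrakk> \<Longrightarrow> B a (b + c) = B a b + B a c"
    and B_sc_right: "\<lbrakk>a \<in> V; b \<in> V\<rbrakk> \<Longrightarrow> B a (sc z b) = z * B a b"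
    and B_herm: "\<lbrakk>a \<in> V; b \<in> V\<rbrakk> \<Longrightarrow> B b a = cnj (B a b)"
    and B_pos: "a \<in> V \<Longrightarrow> 0 \<le> Re (B a a)"
begin

definition nrm :: "'v \<Rightarrow> real" where "nrm a = sqrt (Re (B a a))"

definition cauchy_seq :: "(nat \<Rightarrow> 'v) \<Rightarrow> bool" where
  "cauchy_seq s \<longleftrightarrow> (\<forall>n. s n \<in> V) \<and> (\<forall>e>0. \<exists>N. \<forall>m\<ge>N. \<forall>n\<ge>N. nrm (s m - s n) < e)"

lemma V_minus: "a \<in> V \<Longrightarrow> b \<in> V \<Longrightarrow> a - b \<in> V"
  using V_add[of a "sc (-1) b"] V_sc[of b "-1"] by (simp add: sc_neg)

lemma B_add_left: "\<lbrakk>a \<in> V; b \<in> V; c \<in> V\<rbrakk> \<Longrightarrow> B (a + b) c = B a c + B b c"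
  by (metis B_herm B_add_right V_add complex_cnj_add)

lemma B_sc_left: "\<lbrakk>a \<in> V; b \<in> V\<rbrakk> \<Longrightarrow> B (sc z a) b = cnj z * B a b"
  by (metis B_herm B_sc_right V_sc complex_cnj_mult)

lemma B_minus_right: "\<lbrakk>a \<in> V; b \<in> V; c \<in> V\<rbrakk> \<Longrightarrow> B a (b - c) = B a b - B a c"
  using B_add_right[of a b "sc (-1) c"] B_sc_right[of a c "-1"] V_sc[of c "-1"]
  by (simp add: sc_neg)

lemma B_minus_left: "\<lbrakk>a \<in> V; b \<in> V; c \<in> V\<rbrakk> \<Longrightarrow> B (a - b) c = B a c - B b c"
  using B_add_left[of a "sc (-1) b" c] B_sc_left[of b c "-1"] V_sc[of b "-1"]
  by (simp add: sc_neg)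

lemma nrm_ge_0: "a \<in> V \<Longrightarrow> 0 \<le> nrm a"
  by (simp add: nrm_def B_pos)

lemma nrm_sq: "a \<in> V \<Longrightarrow> (nrm a)\<^sup>2 = Re (B a a)"
  by (simp add: nrm_def B_pos)

lemma B_self: "a \<in> V \<Longrightarrow> B a a = complex_of_real ((nrm a)\<^sup>2)"
  using B_herm[of a a] by (simp add: nrm_sq complex_eq_iff)

text \<open>Positivity of this quadratic in \<open>c\<close> yields Cauchy-Schwarz; its values at
  \<open>1\<close> and \<open>- 1\<close> yield the triangle inequality and the parallelogram
  law.\<close>

lemma B_expand:
  assumes "a \<in> V" "b \<in> V"
  shows "Re (B (a + sc c b) (a + sc c b)) = Re (B a a) + 2 * Re (c * B a b) + (cmod c)\<^sup>2 * Re (B b b)"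
proof -
  have "B (a + sc c b) (a + sc c b) = B a a + c * B a b + cnj c * cnj (B a b) + cnj c * c * B b b"
    using assms by (simp add: B_add_left B_add_right V_add V_sc B_sc_left B_sc_right B_herm[of a b] algebra_simps)
  moreover have "cnj c * c = complex_of_real ((cmod c)\<^sup>2)"
    using complex_norm_square[of c] by (simp add: mult.commute)
  ultimately show ?thesis by simp
qed

lemma cauchy_schwarz_sq:
  assumes "a \<in> V" "b \<in> V"
  shows "(cmod (B a b))\<^sup>2 \<le> Re (B a a) * Re (B b b)"
proof -
  define z where "z = (cmod (B a b))\<^sup>2"
  have z: "0 \<le> z" by (simp add: z_def)
  have key: "0 \<le> Re (B a a) - 2 * t * z + t\<^sup>2 * z * Re (B b b)" for t :: real
  proof -
    \<comment> \<open>This phase makes the linear term real: it becomes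
      \<open>- 2 * t * z\<close>.\<close>
    let ?c = "- of_real t * cnj (B a b)"
    have "B a b * cnj (B a b) = of_real z"
      by (metis complex_norm_square z_def)
    then have 1: "Re (?c * B a b) = - t * z"
      by (simp add: mult.assoc mult.commute[of "cnj (B a b)"])
    have 2: "(cmod ?c)\<^sup>2 = t\<^sup>2 * z"
      by (simp add: norm_mult power_mult_distrib z_def)
    have "0 \<le> Re (B (a + sc ?c b) (a + sc ?c b))" using assms by (simp add: B_pos V_add V_sc)
    also have "\<dots> = Re (B a a) + 2 * (- t * z) + t\<^sup>2 * z * Re (B b b)"
      by (simp only: B_expand[OF assms] 1 2)
    finally show ?thesis by simp
  qed
  show ?thesis
  proof (cases "Re (B b b) = 0")
    case True
    have "z = 0"
    proof (rule ccontr)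
      assume "z \<noteq> 0"
      \<comment> \<open>For this \<open>t\<close> one has \<open>2 * t * z = Re (B a a) + 1\<close>
        and no quadratic term, so the right side of \<open>key\<close> is
        \<open>- 1\<close>.\<close>
      then show False
        using key[of "(Re (B a a) + 1) / (2 * z)"] True by simp
    qed
    then show ?thesis using True by (simp add: z_def)
  next
    case False
    then have pos: "0 < Re (B b b)" using B_pos[OF assms(2)] by simp
    have "0 \<le> Re (B a a) - z / Re (B b b)"
      using key[of "1 / Re (B b b)"] pos by (simp add: power2_eq_square)
    then show ?thesis using pos by (simp add: z_def field_simps)
  qed
qed

lemma cauchy_schwarz:
  assumes "a \<in> V" "b \<in> V"
  shows "cmod (B a b) \<le> nrm a * nrm b"
proof -
  have "sqrt ((cmod (B a b))\<^sup>2) \<le> sqrt (Re (B a a) * Re (B b b))"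
    using cauchy_schwarz_sq[OF assms] real_sqrt_le_mono by blast
  then show ?thesis by (simp add: nrm_def real_sqrt_mult)
qed

lemma nrm_triangle:
  assumes "a \<in> V" "b \<in> V"
  shows "nrm (a + b) \<le> nrm a + nrm b"
proof (rule power2_le_imp_le)
  have "(nrm (a + b))\<^sup>2 = (nrm a)\<^sup>2 + 2 * Re (B a b) + (nrm b)\<^sup>2"
    using B_expand[OF assms, of 1] assms by (simp add: nrm_sq V_add sc_one)
  also have "Re (B a b) \<le> nrm a * nrm b"
    using cauchy_schwarz[OF assms] complex_Re_le_cmod order_trans by blast
  finally show "(nrm (a + b))\<^sup>2 \<le> (nrm a + nrm b)\<^sup>2" by (simp add: power2_sum)
  show "0 \<le> nrm a + nrm b" using assms by (simp add: nrm_ge_0)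
qed

lemma cauchy_seq_bounded:
  assumes "cauchy_seq s"
  obtains C where "0 < C" "\<And>n. nrm (s n) \<le> C"
proof -
  have V: "s n \<in> V" for n using assms by (simp add: cauchy_seq_def)
  obtain N where N: "\<And>m n. m \<ge> N \<Longrightarrow> n \<ge> N \<Longrightarrow> nrm (s m - s n) < 1"
    using assms unfolding cauchy_seq_def by (meson zero_less_one)
  define C where "C = 1 + nrm (s N) + (\<Sum>i<N. nrm (s i))"
  have nn: "0 \<le> (\<Sum>i<N. nrm (s i))" by (simp add: V nrm_ge_0 sum_nonneg)
  have "nrm (s n) \<le> C" for n
  proof (cases "n < N")
    case True
    then have "nrm (s n) \<le> (\<Sum>i<N. nrm (s i))"
      by (intro member_le_sum) (auto simp: V nrm_ge_0)
    then show ?thesis using nrm_ge_0[OF V, of N] by (simp add: C_def)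
  next
    case False
    have "nrm (s n) \<le> nrm (s N) + nrm (s n - s N)"
      using nrm_triangle[OF V[of N] V_minus[OF V[of n] V[of N]]] by simp
    then show ?thesis using N[of n N] False nn by (simp add: C_def)
  qed
  moreover have "0 < C" using nn nrm_ge_0[OF V, of N] by (simp add: C_def)
  ultimately show ?thesis using that by blast
qed

lemma B_cauchy_seq_convergent:
  assumes "cauchy_seq s" "b \<in> V"
  shows "convergent (\<lambda>n. B (s n) b)"
proof -
  have V: "s n \<in> V" for n using assms by (simp add: cauchy_seq_def)
  have "Cauchy (\<lambda>n. B (s n) b)"
  proof (rule metric_CauchyI)
    fix e :: real assume e: "0 < e"
    \<comment> \<open>The seminorm of \<open>b\<close> may vanish, hence the
      \<open>+ 1\<close>.\<close>
    then have "0 < e / (nrm b + 1)" using nrm_ge_0[OF assms(2)] by simp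
    then obtain N where N: "\<And>m n. m \<ge> N \<Longrightarrow> n \<ge> N \<Longrightarrow> nrm (s m - s n) < e / (nrm b + 1)"
      using assms unfolding cauchy_seq_def by metis
    have "dist (B (s m) b) (B (s n) b) < e" if "m \<ge> N" "n \<ge> N" for m n
    proof -
      have "dist (B (s m) b) (B (s n) b) = cmod (B (s m - s n) b)"
        by (simp add: dist_norm B_minus_left V assms)
      also have "\<dots> \<le> nrm (s m - s n) * nrm b"
        by (simp add: cauchy_schwarz V V_minus assms)
      also have "\<dots> \<le> nrm (s m - s n) * (nrm b + 1)"
        by (intro mult_left_mono) (simp_all add: nrm_ge_0 V V_minus)
      also have "\<dots> < e"
        using N[OF that] nrm_ge_0[OF assms(2)] by (simp add: field_simps)
      finally show ?thesis .
    qed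
    then show "\<exists>M. \<forall>m\<ge>M. \<forall>n\<ge>M. dist (B (s m) b) (B (s n) b) < e" by blast
  qed
  then show ?thesis by (simp add: Cauchy_convergent_iff)
qed

lemma B_tendsto_0:
  assumes "\<And>n. u n \<in> V" "(\<lambda>n. nrm (u n)) \<longlonglongrightarrow> 0" "b \<in> V"
  shows "(\<lambda>n. B (u n) b) \<longlonglongrightarrow> 0"
proof (rule Lim_null_comparison)
  show "\<forall>\<^sub>F n in sequentially. cmod (B (u n) b) \<le> nrm (u n) * nrm b"
    by (simp add: assms cauchy_schwarz)
  show "(\<lambda>n. nrm (u n) * nrm b) \<longlonglongrightarrow> 0"
    using tendsto_mult_right[OF assms(2), of "nrm b"] by simp
qed

lemma cauchy_seq_minus:
  assumes "cauchy_seq s" "cauchy_seq t"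
  shows "cauchy_seq (\<lambda>n. s n - t n)"
  unfolding cauchy_seq_def
proof (intro conjI allI impI)
  have V: "s n \<in> V" "t n \<in> V" for n using assms by (auto simp: cauchy_seq_def)
  show "s n - t n \<in> V" for n by (simp add: V V_minus)
  fix e :: real assume "0 < e"
  then have e: "0 < e / 2" by simp
  obtain N1 where N1: "\<And>m n. m \<ge> N1 \<Longrightarrow> n \<ge> N1 \<Longrightarrow> nrm (s m - s n) < e / 2"
    using assms(1) e unfolding cauchy_seq_def by metis
  obtain N2 where N2: "\<And>m n. m \<ge> N2 \<Longrightarrow> n \<ge> N2 \<Longrightarrow> nrm (t m - t n) < e / 2"
    using assms(2) e unfolding cauchy_seq_def by metis
  have "nrm (s m - t m - (s n - t n)) < e" if "m \<ge> max N1 N2" "n \<ge> max N1 N2" for m n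
  proof -
    have "nrm (s m - t m - (s n - t n)) = nrm ((s m - s n) + (t n - t m))"
      by (simp add: algebra_simps)
    also have "\<dots> \<le> nrm (s m - s n) + nrm (t n - t m)"
      by (simp add: nrm_triangle V V_minus)
    finally show ?thesis using N1[of m n] N2[of n m] that by simp
  qed
  then show "\<exists>N. \<forall>m\<ge>N. \<forall>n\<ge>N. nrm (s m - t m - (s n - t n)) < e" by blast
qed

text \<open>Split the square as \<open>B (u n) (u N) + B (u n) (u n - u N)\<close>: for fixed
  \<open>N\<close> the first term is small by weak convergence, the second by the Cauchy property
  and boundedness. Consequently two Cauchy sequences representing the same functional are
  equivalent.\<close>

lemma cauchy_seq_weak_limit_unique:
  assumes "cauchy_seq u" and weak: "\<And>b. b \<in> V \<Longrightarrow> (\<lambda>n. B (u n) b) \<longlonglongrightarrow> 0"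
  shows "(\<lambda>n. nrm (u n)) \<longlonglongrightarrow> 0"
proof (rule LIMSEQ_I)
  have V: "u n \<in> V" for n using assms by (auto simp: cauchy_seq_def)
  obtain C where C: "0 < C" "\<And>n. nrm (u n) \<le> C" using cauchy_seq_bounded[OF assms(1)] by blast
  fix e :: real assume e: "0 < e"
  then have "0 < e\<^sup>2 / (2 * C)" using C by simp
  then obtain N where N: "\<And>m n. m \<ge> N \<Longrightarrow> n \<ge> N \<Longrightarrow> nrm (u m - u n) < e\<^sup>2 / (2 * C)"
    using assms(1) unfolding cauchy_seq_def by metis
  obtain M where M: "\<And>n. n \<ge> M \<Longrightarrow> cmod (B (u n) (u N)) < e\<^sup>2 / 2"
    using LIMSEQ_D[OF weak[OF V[of N]], of "e\<^sup>2 / 2"] e by auto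
  have "norm (nrm (u n) - 0) < e" if n: "n \<ge> max M N" for n
  proof -
    have "(nrm (u n))\<^sup>2 = cmod (B (u n) (u n))"
      using V by (simp add: B_self norm_power)
    also have "\<dots> = cmod (B (u n) (u N) + B (u n) (u n - u N))"
      by (simp add: B_minus_right V)
    also have "\<dots> \<le> cmod (B (u n) (u N)) + cmod (B (u n) (u n - u N))"
      by (rule norm_triangle_ineq)
    also have "\<dots> \<le> cmod (B (u n) (u N)) + nrm (u n) * nrm (u n - u N)"
      by (simp add: cauchy_schwarz V V_minus)
    also have "\<dots> \<le> cmod (B (u n) (u N)) + C * nrm (u n - u N)"
      by (simp add: C mult_right_mono nrm_ge_0 V V_minus)
    also have "\<dots> < e\<^sup>2 / 2 + C * (e\<^sup>2 / (2 * C))"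
      using M[of n] N[of n N] n C by (intro add_strict_mono mult_strict_left_mono) auto
    also have "\<dots> = e\<^sup>2" using C by simp
    finally have "nrm (u n) < e" using e by (simp add: power2_less_imp_less)
    then show ?thesis using nrm_ge_0[OF V, of n] by simp
  qed
  then show "\<exists>no. \<forall>n\<ge>no. norm (nrm (u n) - 0) < e" by blast
qed

text \<open>A minimising sequence of \<open>\<parallel>a\<parallel>\<^sup>2 - 2 Re (q a)\<close> is Cauchy by the parallelogram law, and
  its weak limit represents \<open>q\<close>; no completeness is involved.\<close>

theorem riesz_cauchy_seq:
  assumes q_add: "\<And>a b. \<lbrakk>a \<in> V; b \<in> V\<rbrakk> \<Longrightarrow> q (a + b) = q a + q b"
    and q_sc: "\<And>a z. a \<in> V \<Longrightarrow> q (sc z a) = z * q a"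
    and q_bd: "\<And>a. a \<in> V \<Longrightarrow> cmod (q a) \<le> C * nrm a"
  obtains s where "cauchy_seq s" "\<And>b. b \<in> V \<Longrightarrow> (\<lambda>n. B (s n) b) \<longlonglongrightarrow> q b"
proof -
  define J where "J a = (nrm a)\<^sup>2 - 2 * Re (q a)" for a
  have low: "- C\<^sup>2 \<le> J a" if "a \<in> V" for a
  proof -
    have "Re (q a) \<le> C * nrm a" using q_bd[OF that] complex_Re_le_cmod order_trans by blast
    moreover have "0 \<le> (nrm a - C)\<^sup>2" by simp
    ultimately show ?thesis by (simp add: J_def power2_diff mult.commute mult.assoc)
  qed
  define \<mu> where "\<mu> = Inf (J ` V)"
  have bdd: "bdd_below (J ` V)" using low by (intro bdd_belowI[of _ "- C\<^sup>2"]) auto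
  have mu: "\<mu> \<le> J a" if "a \<in> V" for a
    using that bdd by (simp add: \<mu>_def cInf_lower)
  have "\<exists>a\<in>V. J a < \<mu> + 1 / real (Suc n)" for n
  proof -
    have "Inf (J ` V) < \<mu> + 1 / real (Suc n)" by (simp add: \<mu>_def)
    then show ?thesis using cInf_lessD[of "J ` V"] V_zero by blast
  qed
  then obtain s where V: "\<And>n. s n \<in> V" and s: "\<And>n. J (s n) < \<mu> + 1 / real (Suc n)" by metis
  have J_expand: "J (a + sc c b) = J a + 2 * Re (c * (B a b - q b)) + (cmod c)\<^sup>2 * (nrm b)\<^sup>2"
    if "a \<in> V" "b \<in> V" for a b c
    using that B_expand[OF that, of c] by (simp add: J_def nrm_sq V_add V_sc q_add q_sc algebra_simps)
  \<comment> \<open>The midpoint \<open>?h\<close> has \<open>J ?h\<close> at least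
    \<open>\<mu>\<close>, and by the parallelogram law \<open>4 * J ?h\<close> falls short of
    \<open>2 * (J a + J b)\<close> by exactly the squared distance.\<close>
  have par: "(nrm (a - b))\<^sup>2 \<le> 2 * (J a + J b) - 4 * \<mu>" if ab: "a \<in> V" "b \<in> V" for a b
  proof -
    let ?h = "sc (1/2) (a + b)"
    have h: "(nrm ?h)\<^sup>2 = Re (B (a + b) (a + b)) / 4"
      using ab by (simp add: nrm_sq V_add V_sc B_sc_left B_sc_right)
    have p: "Re (B (a + b) (a + b)) = 2 * (nrm a)\<^sup>2 + 2 * (nrm b)\<^sup>2 - (nrm (a - b))\<^sup>2"
      using B_expand[OF ab, of 1] B_expand[OF ab, of "-1"] ab
      by (simp add: sc_one sc_neg nrm_sq V_minus)
    have "4 * J ?h = 2 * (J a + J b) - (nrm (a - b))\<^sup>2"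
      using ab by (simp add: J_def h p q_sc q_add V_add field_simps)
    moreover have "\<mu> \<le> J ?h" using ab by (simp add: mu V_add V_sc)
    ultimately show ?thesis by simp
  qed
  have "cauchy_seq s"
    unfolding cauchy_seq_def
  proof (intro conjI allI impI V)
    fix e :: real assume e: "0 < e"
    \<comment> \<open>If both values of \<open>J\<close> exceed \<open>\<mu>\<close> by less than
      \<open>e\<^sup>2 / 4\<close>, then \<open>par\<close> bounds the squared distance by
      \<open>e\<^sup>2\<close>.\<close>
    then have "0 < e\<^sup>2 / 4" by simp
    then obtain N where N: "inverse (real (Suc N)) < e\<^sup>2 / 4"
      using reals_Archimedean by blast
    have "nrm (s m - s n) < e" if "m \<ge> N" "n \<ge> N" for m n
    proof -
      have inv: "1 / real (Suc k) < e\<^sup>2 / 4" if "k \<ge> N" for k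
        using N that by (smt (verit) frac_le inverse_eq_divide of_nat_0_less_iff of_nat_le_iff Suc_le_mono zero_less_Suc)
      have "(nrm (s m - s n))\<^sup>2 < e\<^sup>2"
        using par[OF V V, of m n] s[of m] s[of n] inv[OF that(1)] inv[OF that(2)] by argo
      then show ?thesis using e by (simp add: power2_less_imp_less)
    qed
    then show "\<exists>N. \<forall>m\<ge>N. \<forall>n\<ge>N. nrm (s m - s n) < e" by blast
  qed
  moreover have "(\<lambda>n. B (s n) b) \<longlonglongrightarrow> q b" if b: "b \<in> V" for b
  proof -
    \<comment> \<open>Let \<open>z\<close> be the defect \<open>B (s n) b - q b\<close>. Moving
      \<open>s n\<close> along \<open>b\<close> with coefficient \<open>- \<tau> * cnj z\<close>
      lowers \<open>J\<close> by \<open>2 * \<tau> * (cmod z)\<^sup>2\<close> to first order, and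
      this size of \<open>\<tau>\<close> lets the quadratic term take back at most half.
      Near-minimality of \<open>s n\<close> then forces \<open>z\<close> to be small.\<close>
    define \<tau> where "\<tau> = 1 / ((nrm b)\<^sup>2 + 1)"
    have "0 < (nrm b)\<^sup>2 + 1" by (simp add: add_nonneg_pos)
    then have tau: "0 < \<tau>" "\<tau> * (nrm b)\<^sup>2 \<le> 1"
      by (simp_all add: \<tau>_def divide_le_eq)
    have bd: "(cmod (B (s n) b - q b))\<^sup>2 \<le> (1 / real (Suc n)) / \<tau>" for n
    proof -
      define z where "z = B (s n) b - q b"
      let ?c = "- of_real \<tau> * cnj z"
      have "z * cnj z = of_real ((cmod z)\<^sup>2)" using complex_norm_square[of z] by simp
      then have 1: "Re (?c * z) = - \<tau> * (cmod z)\<^sup>2"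
        by (simp add: mult.assoc mult.commute[of "cnj z"])
      have 2: "(cmod ?c)\<^sup>2 = \<tau>\<^sup>2 * (cmod z)\<^sup>2" by (simp add: norm_mult power_mult_distrib)
      have "\<mu> \<le> J (s n + sc ?c b)" using V b by (simp add: mu V_add V_sc)
      also have "\<dots> = J (s n) + 2 * (- \<tau> * (cmod z)\<^sup>2) + \<tau>\<^sup>2 * (cmod z)\<^sup>2 * (nrm b)\<^sup>2"
        using J_expand[OF V[of n] b, of ?c] unfolding z_def[symmetric] by (simp only: 1 2)
      also have "\<tau>\<^sup>2 * (cmod z)\<^sup>2 * (nrm b)\<^sup>2 = (\<tau> * (cmod z)\<^sup>2) * (\<tau> * (nrm b)\<^sup>2)"
        by (simp add: power2_eq_square)
      also have "\<dots> \<le> \<tau> * (cmod z)\<^sup>2"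
        using tau by (intro mult_left_le) auto
      finally have "\<tau> * (cmod z)\<^sup>2 \<le> 1 / real (Suc n)" using s[of n] by simp
      then show ?thesis unfolding z_def[symmetric] using tau(1) by (simp only: pos_le_divide_eq mult.commute)
    qed
    have "(\<lambda>n. (1 / real (Suc n)) / \<tau>) \<longlonglongrightarrow> 0"
      using tendsto_divide_zero[OF LIMSEQ_inverse_real_of_nat] by (simp add: inverse_eq_divide)
    then have "(\<lambda>n. (cmod (B (s n) b - q b))\<^sup>2) \<longlonglongrightarrow> 0"
      by (rule Lim_null_comparison[rotated]) (use bd in auto)
    then have "(\<lambda>n. B (s n) b - q b) \<longlonglongrightarrow> 0"
      by (simp add: tendsto_norm_zero_iff)
    then show ?thesis by (simp add: LIM_zero_iff)
  qed
  ultimately show ?thesis using that by blast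
qed

end

section \<open>Sums over the lattice\<close>

text \<open>Sup-norm balls instead of the balls \<open>lball\<close>: as products of intervals they
  have explicit cardinalities, and sums of product weights over them factorise.\<close>

definition cube :: "nat \<Rightarrow> (int^'d) set" where
  "cube j = {x. \<forall>i. \<bar>x $ i\<bar> \<le> int j}"

lemma cube_eq_image: "cube j = vec_lambda ` (\<Pi>\<^sub>E i\<in>UNIV. {- int j..int j})"
proof (intro equalityI subsetI)
  fix x :: "int^'d" assume "x \<in> cube j"
  then have "vec_nth x \<in> (\<Pi>\<^sub>E i\<in>UNIV. {- int j..int j})"
    by (auto simp: cube_def abs_le_iff minus_le_iff)
  then show "x \<in> vec_lambda ` (\<Pi>\<^sub>E i\<in>UNIV. {- int j..int j})"
    by (metis image_eqI vec_nth_inverse)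
next
  fix x :: "int^'d" assume "x \<in> vec_lambda ` (\<Pi>\<^sub>E i\<in>UNIV. {- int j..int j})"
  then obtain g where g: "x = vec_lambda g" "g \<in> (\<Pi>\<^sub>E i\<in>UNIV. {- int j..int j})"
    by (rule imageE)
  have "\<bar>g i\<bar> \<le> int j" for i using PiE_mem[OF g(2), of i] by auto
  then show "x \<in> cube j" by (simp add: g(1) cube_def)
qed

lemma inj_on_vec_lambda: "inj_on vec_lambda A"
  by (rule inj_on_inverseI[of _ vec_nth]) (simp add: vec_lambda_inverse)

lemma finite_cube: "finite (cube j)"
  by (simp add: cube_eq_image finite_PiE)

lemma card_cube: "card (cube j :: (int^'d) set) = (2 * j + 1) ^ CARD('d)"
  by (simp add: cube_eq_image card_image[OF inj_on_vec_lambda] card_PiE nat_add_distrib nat_mult_distrib)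

lemma cube_mono: "i \<le> j \<Longrightarrow> cube i \<subseteq> cube j"
  unfolding cube_def by (auto intro: order_trans)

lemma zero_in_cube: "0 \<in> cube j"
  by (simp add: cube_def)

lemma cube_minus: "x \<in> cube i \<Longrightarrow> y \<in> cube j \<Longrightarrow> x - y \<in> cube (i + j)"
proof -
  assume x: "x \<in> cube i" and y: "y \<in> cube j"
  have "\<bar>(x - y) $ k\<bar> \<le> int (i + j)" for k
  proof -
    have "\<bar>x $ k\<bar> \<le> int i" "\<bar>y $ k\<bar> \<le> int j" using x y by (auto simp: cube_def)
    then show ?thesis by simp
  qed
  then show ?thesis by (simp add: cube_def)
qed

lemma sum_cube_prod:
  fixes h :: "int \<Rightarrow> real"
  shows "(\<Sum>x\<in>(cube j :: (int^'d) set). \<Prod>i\<in>UNIV. h (x $ i)) = (\<Sum>n\<in>{- int j..int j}. h n) ^ CARD('d)"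
proof -
  have "(\<Prod>i\<in>(UNIV::'d set). \<Sum>n\<in>{- int j..int j}. h n)
      = (\<Sum>g\<in>(\<Pi>\<^sub>E i\<in>(UNIV::'d set). {- int j..int j}). \<Prod>i\<in>UNIV. h (g i))"
    by (rule prod_sum_PiE) auto
  then show ?thesis
    by (simp add: cube_eq_image sum.reindex[OF inj_on_vec_lambda])
qed

lemma abs_nth_le_ldist: "\<bar>x $ i\<bar> \<le> ldist x 0"
  unfolding ldist_def using member_le_sum[of i UNIV "\<lambda>i. \<bar>x $ i\<bar>"] by simp

lemma ldist_nonneg: "0 \<le> ldist x y"
  by (simp add: ldist_def sum_nonneg)

lemma ldist_le_cube:
  fixes x :: "int^'d"
  assumes "x \<in> cube j"
  shows "ldist x 0 \<le> int (CARD('d) * j)"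
proof -
  have "(\<Sum>i\<in>UNIV. \<bar>x $ i\<bar>) \<le> (\<Sum>i\<in>(UNIV::'d set). int j)"
    using assms by (intro sum_mono) (simp add: cube_def)
  then show ?thesis by (simp add: ldist_def)
qed

lemma ldist_triangle_add: "ldist (x + y) 0 \<le> ldist x 0 + ldist y 0"
  by (simp add: ldist_def sum.distrib[symmetric] sum_mono abs_triangle_ineq)

lemma ldist_triangle3: "ldist z 0 \<le> ldist y 0 + ldist (x + z) y + ldist x 0"
proof -
  have "\<bar>z $ i\<bar> \<le> \<bar>y $ i\<bar> + \<bar>(x + z) $ i - y $ i\<bar> + \<bar>x $ i\<bar>" for i
    by simp
  then show ?thesis
    unfolding ldist_def by (simp only: sum.distrib[symmetric] zero_index diff_zero) (rule sum_mono)
qed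

lemma lball_subset_cube: "lball r \<subseteq> cube (nat \<lfloor>r\<rfloor>)"
proof
  fix x :: "int^'d" assume "x \<in> lball r"
  then have "ldist x 0 \<le> \<lfloor>r\<rfloor>" by (simp add: lball_def le_floor_iff)
  then have "\<bar>x $ i\<bar> \<le> int (nat \<lfloor>r\<rfloor>)" for i
    using abs_nth_le_ldist[of x i] by linarith
  then show "x \<in> cube (nat \<lfloor>r\<rfloor>)" by (simp add: cube_def)
qed

lemma finite_lball: "finite (lball r)"
  using lball_subset_cube finite_cube finite_subset by blast

lemma finite_subset_lball:
  assumes "finite X"
  obtains r :: nat where "X \<subseteq> lball (real r)"
proof -
  have "X \<subseteq> lball (real (nat (\<Sum>x\<in>X. ldist x 0)))"
  proof
    fix x assume "x \<in> X"
    then have "ldist x 0 \<le> (\<Sum>x\<in>X. ldist x 0)"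
      using assms by (intro member_le_sum) (auto simp: ldist_nonneg)
    then show "x \<in> lball (real (nat (\<Sum>x\<in>X. ldist x 0)))"
      by (simp add: lball_def)
  qed
  then show ?thesis using that by blast
qed

lemma finite_subset_cube:
  assumes "finite X"
  obtains j where "X \<subseteq> cube j"
  using finite_subset_lball[OF assms] lball_subset_cube by (metis order_trans)

text \<open>Only an inequality, since the right side counts \<open>h 0\<close> twice.\<close>

lemma sum_symmetric_interval_le:
  fixes h :: "nat \<Rightarrow> real"
  assumes "\<And>k. 0 \<le> h k"
  shows "(\<Sum>n\<in>{- int j..int j}. h (nat \<bar>n\<bar>)) \<le> 2 * (\<Sum>k\<le>j. h k)"
proof (induction j)
  case 0
  then show ?case using assms[of 0] by simp
next
  case (Suc j)
  have "{- int (Suc j)..int (Suc j)} = insert (int (Suc j)) (insert (- int (Suc j)) {- int j..int j})"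
    by auto
  then have "(\<Sum>n\<in>{- int (Suc j)..int (Suc j)}. h (nat \<bar>n\<bar>))
      = (\<Sum>n\<in>{- int j..int j}. h (nat \<bar>n\<bar>)) + 2 * h (Suc j)"
    by (simp add: nat_add_distrib)
  then show ?case using Suc by simp
qed

text \<open>Every coordinate is at most the length of \<open>x\<close>, so the weight is bounded by
  the product over the coordinates of \<open>(1 + \<bar>x $ i\<bar>) powr (- (p / D))\<close>. The
  sum then factorises into \<open>D\<close> one-dimensional series, convergent because
  \<open>p / D > 1\<close>.\<close>

lemma summable_lattice_weight:
  assumes p: "real CARD('d) < p"
  shows "(\<lambda>x::int^'d. (1 + real_of_int (ldist x 0)) powr (- p)) summable_on UNIV"
proof -
  define D where "D = CARD('d)"
  have D: "0 < D" by (simp add: D_def)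
  define h where "h k = (1 + real k) powr (- (p / real D))" for k
  have hpos: "0 \<le> h k" for k by (simp add: h_def)
  have "summable (\<lambda>k. real k powr (- (p / real D)))"
    using p D by (subst summable_real_powr_iff) (simp add: D_def)
  then have sh: "summable h"
    unfolding h_def using summable_Suc_iff[of "\<lambda>k. real k powr (- (p / real D))"]
    by (simp add: add.commute)
  define M where "M = (2 * suminf h) ^ D"
  have le: "(1 + real_of_int (ldist x 0)) powr (- p) \<le> (\<Prod>i\<in>UNIV. h (nat \<bar>x $ i\<bar>))" for x :: "int^'d"
  proof -
    have pos: "0 < 1 + real_of_int (ldist x 0)" using ldist_nonneg[of x 0] by (simp add: add_pos_nonneg)
    have "(1 + real_of_int (ldist x 0)) powr (- p)
        = (\<Prod>i\<in>(UNIV::'d set). (1 + real_of_int (ldist x 0)) powr (- (p / real D)))"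
      using D pos by (simp add: powr_realpow[symmetric] powr_powr D_def[symmetric])
    also have "\<dots> \<le> (\<Prod>i\<in>UNIV. h (nat \<bar>x $ i\<bar>))"
    proof (intro prod_mono conjI)
      fix i
      have "real (nat \<bar>x $ i\<bar>) \<le> real_of_int (ldist x 0)"
        using abs_nth_le_ldist[of x i] by linarith
      then show "(1 + real_of_int (ldist x 0)) powr (- (p / real D)) \<le> h (nat \<bar>x $ i\<bar>)"
        unfolding h_def using p D by (intro powr_mono2') (auto simp: D_def)
    qed auto
    finally show ?thesis .
  qed
  have "sum (\<lambda>x. (1 + real_of_int (ldist x 0)) powr (- p)) F \<le> M" if F: "finite F" for F :: "(int^'d) set"
  proof -
    obtain j where j: "F \<subseteq> cube j" using finite_subset_cube[OF F] by blast
    have "sum (\<lambda>x. (1 + real_of_int (ldist x 0)) powr (- p)) F \<le> (\<Sum>x\<in>F. \<Prod>i\<in>UNIV. h (nat \<bar>x $ i\<bar>))"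
      by (intro sum_mono le)
    also have "\<dots> \<le> (\<Sum>x\<in>(cube j :: (int^'d) set). \<Prod>i\<in>UNIV. h (nat \<bar>x $ i\<bar>))"
      by (intro sum_mono2 finite_cube j prod_nonneg hpos)
    also have "\<dots> = (\<Sum>n\<in>{- int j..int j}. h (nat \<bar>n\<bar>)) ^ D"
      by (simp add: sum_cube_prod[of "\<lambda>n. h (nat \<bar>n\<bar>)"] D_def)
    also have "\<dots> \<le> (2 * (\<Sum>k\<le>j. h k)) ^ D"
      by (intro power_mono sum_symmetric_interval_le hpos sum_nonneg)
    also have "\<dots> \<le> (2 * suminf h) ^ D"
      using sh hpos by (intro power_mono mult_left_mono sum_le_suminf mult_nonneg_nonneg sum_nonneg) auto
    finally show ?thesis by (simp add: M_def)
  qed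
  then show ?thesis
    by (intro nonneg_bdd_above_summable_on bdd_aboveI[of _ M]) auto
qed

text \<open>The bound depends on the core \<open>C\<close> alone and not on the finite set
  \<open>A\<close> around it, so one tail serves a whole family of shifted cubes.\<close>

lemma norm_sum_minus_infsum_le:
  fixes g :: "'x \<Rightarrow> complex"
  assumes g: "(\<lambda>x. cmod (g x)) summable_on UNIV" and "finite A" "C \<subseteq> A"
  shows "cmod (sum g A - infsum g UNIV) \<le> infsum (\<lambda>z. cmod (g z)) (- C)"
proof -
  have s: "g summable_on X" "(\<lambda>x. cmod (g x)) summable_on X" for X
    using summable_on_subset_banach[OF abs_summable_summable[OF g], of X]
      summable_on_subset_banach[OF g, of X] by simp_all
  have "infsum g UNIV = infsum g A + infsum g (- A)"
    using infsum_Un_disjoint[OF s(1)[of A] s(1)[of "- A"]] by simp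
  then have "cmod (sum g A - infsum g UNIV) = cmod (infsum g (- A))"
    using \<open>finite A\<close> by simp
  also have "\<dots> \<le> infsum (\<lambda>z. cmod (g z)) (- A)"
    using s(2) by (rule norm_infsum_bound)
  also have "\<dots> \<le> infsum (\<lambda>z. cmod (g z)) (- C)"
    using s(2) \<open>C \<subseteq> A\<close> by (intro infsum_mono_neutral) auto
  finally show ?thesis .
qed

lemma cube_tail_tendsto_0:
  fixes g :: "int^'d \<Rightarrow> real"
  assumes g: "g summable_on UNIV" and pos: "\<And>x. 0 \<le> g x"
  shows "(\<lambda>j. infsum g (- cube j)) \<longlonglongrightarrow> 0"
proof (rule LIMSEQ_I)
  fix e :: real assume e: "0 < e"
  have s: "g summable_on X" for X using summable_on_subset_banach[OF g, of X] by simp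
  have "(g has_sum infsum g UNIV) UNIV" using g by simp
  then have "\<forall>\<^sub>F F in finite_subsets_at_top UNIV. dist (sum g F) (infsum g UNIV) < e"
    using e unfolding has_sum_def tendsto_iff by blast
  then obtain X where X: "finite X" "\<And>F. finite F \<Longrightarrow> X \<subseteq> F \<Longrightarrow> dist (sum g F) (infsum g UNIV) < e"
    unfolding eventually_finite_subsets_at_top by auto
  obtain j where j: "X \<subseteq> cube j" using finite_subset_cube[OF X(1)] by blast
  have "norm (infsum g (- cube i) - 0) < e" if "i \<ge> j" for i
  proof -
    have "infsum g UNIV = sum g (cube i) + infsum g (- cube i)"
      using infsum_Un_disjoint[OF s[of "cube i"] s[of "- cube i"]] finite_cube by (simp add: finite_cube)
    moreover have "dist (sum g (cube i)) (infsum g UNIV) < e"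
      using X(2)[OF finite_cube] j cube_mono[OF that] by blast
    ultimately show ?thesis by (simp add: dist_real_def)
  qed
  then show "\<exists>no. \<forall>n\<ge>no. norm (infsum g (- cube n) - 0) < e" by blast
qed

lemma card_cube_ratio_tendsto_1:
  "(\<lambda>j. real (card (cube (j - r) :: (int^'d) set)) / real (card (cube j :: (int^'d) set))) \<longlonglongrightarrow> 1"
proof -
  have "(\<lambda>j. (2 * real (j - r) + 1) / (2 * real j + 1)) \<longlonglongrightarrow> 1"
  proof -
    have "(\<lambda>j. 1 - 2 * real r / (2 * real j + 1)) \<longlonglongrightarrow> 1 - 0"
    proof (intro tendsto_diff tendsto_const tendsto_divide_0[OF tendsto_const])
      have "LIM j sequentially. 1 + 2 * real j :> at_top"
        by (intro filterlim_tendsto_add_at_top[OF tendsto_const]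
            filterlim_tendsto_pos_mult_at_top[OF tendsto_const] filterlim_real_sequentially) auto
      then show "LIM j sequentially. 2 * real j + 1 :> at_infinity"
        by (simp add: add.commute filterlim_at_top_imp_at_infinity)
    qed
    \<comment> \<open>Subtraction on naturals is truncated, so the identity needs
      \<open>r <= j\<close>.\<close>
    moreover have "\<forall>\<^sub>F j in sequentially. 1 - 2 * real r / (2 * real j + 1) = (2 * real (j - r) + 1) / (2 * real j + 1)"
      using eventually_ge_at_top[of r]
      by eventually_elim (simp add: of_nat_diff field_simps add_pos_nonneg)
    ultimately show ?thesis by (simp add: tendsto_cong)
  qed
  then have "(\<lambda>j. ((2 * real (j - r) + 1) / (2 * real j + 1)) ^ CARD('d)) \<longlonglongrightarrow> 1 ^ CARD('d)"
    by (rule tendsto_power)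
  then show ?thesis by (simp add: card_cube power_divide add.commute)
qed

text \<open>The cubes form a Folner sequence: for fixed \<open>r\<close> and all but a vanishing fraction of
  \<open>x \<in> cube j\<close> the differences \<open>x - y\<close>, \<open>y \<in> cube j\<close>, exhaust \<open>cube r\<close>.\<close>

lemma cube_average_tendsto_infsum:
  fixes g :: "int^'d \<Rightarrow> complex"
  assumes g: "(\<lambda>x. cmod (g x)) summable_on UNIV"
  shows "(\<lambda>j. (\<Sum>x\<in>cube j. \<Sum>y\<in>cube j. g (x - y)) / of_nat (card (cube j :: (int^'d) set)))
           \<longlonglongrightarrow> infsum g UNIV"
proof (rule LIMSEQ_I)
  fix e :: real assume e: "0 < e"
  define S where "S = infsum g UNIV"
  define T where "T = infsum (\<lambda>z. cmod (g z)) UNIV"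
  define tl where "tl r = infsum (\<lambda>z. cmod (g z)) (- cube r)" for r
  define N where "N j = real (card (cube j :: (int^'d) set))" for j
  have N: "0 < N j" for j by (simp add: N_def card_cube)
  have T: "0 \<le> T" by (simp add: T_def infsum_nonneg)
  have tl: "tl \<longlonglongrightarrow> 0" unfolding tl_def using g by (intro cube_tail_tendsto_0) auto
  obtain r where r: "tl r < e / 2"
    using order_tendstoD(2)[OF tl, of "e / 2"] e unfolding eventually_sequentially by auto
  have tlr: "0 \<le> tl r" by (simp add: tl_def infsum_nonneg)
  have lim: "(\<lambda>j. T * (1 - N (j - r) / N j)) \<longlonglongrightarrow> T * (1 - 1)"
    unfolding N_def by (intro tendsto_mult tendsto_diff tendsto_const card_cube_ratio_tendsto_1)
  obtain J where J: "\<And>j. j \<ge> J \<Longrightarrow> T * (1 - N (j - r) / N j) < e / 2"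
    using order_tendstoD(2)[OF lim, of "e / 2"] e unfolding eventually_sequentially by auto
  have inner: "(\<Sum>y\<in>cube j. g (x - y)) = sum g ((\<lambda>y. x - y) ` cube j)" for x j
    by (subst sum.reindex) (auto simp: inj_on_def)
  have "cmod ((\<Sum>x\<in>cube j. \<Sum>y\<in>cube j. g (x - y)) / of_nat (card (cube j :: (int^'d) set)) - S) < e"
    if j: "j \<ge> max J r" for j
  proof -
    let ?I = "cube (j - r) :: (int^'d) set" and ?C = "cube j :: (int^'d) set"
    have sub: "?I \<subseteq> ?C" by (simp add: cube_mono)
    have near: "cmod ((\<Sum>y\<in>cube j. g (x - y)) - S) \<le> tl r" if x: "x \<in> ?I" for x
    proof -
      have "cube r \<subseteq> (\<lambda>y. x - y) ` cube j"
      proof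
        fix z :: "int^'d" assume "z \<in> cube r"
        then have "x - z \<in> cube j" using cube_minus[OF x, of z r] j by simp
        then show "z \<in> (\<lambda>y. x - y) ` cube j" by (intro image_eqI[of _ _ "x - z"]) simp_all
      qed
      then show ?thesis unfolding inner S_def tl_def
        by (intro norm_sum_minus_infsum_le g finite_imageI finite_cube)
    qed
    \<comment> \<open>The empty core gives the crude bound \<open>T\<close>; it is affordable since
      it is spent only on the boundary layer \<open>?C - ?I\<close>, a vanishing fraction of the
      cube.\<close>
    have far: "cmod ((\<Sum>y\<in>cube j. g (x - y)) - S) \<le> T" for x
      using norm_sum_minus_infsum_le[OF g finite_imageI[OF finite_cube], of "{}" "\<lambda>y. x - y" j]
      by (simp add: inner S_def T_def)
    have "(\<Sum>x\<in>?C. (\<Sum>y\<in>cube j. g (x - y)) - S) = (\<Sum>x\<in>?C. \<Sum>y\<in>cube j. g (x - y)) - of_real (N j) * S"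
      by (simp add: sum_subtractf N_def)
    then have "(\<Sum>x\<in>?C. \<Sum>y\<in>cube j. g (x - y)) / of_nat (card ?C) - S
        = (\<Sum>x\<in>?C. (\<Sum>y\<in>cube j. g (x - y)) - S) / of_real (N j)"
      using N[of j] by (simp add: N_def diff_divide_distrib)
    then have "cmod ((\<Sum>x\<in>?C. \<Sum>y\<in>cube j. g (x - y)) / of_nat (card ?C) - S)
        = cmod (\<Sum>x\<in>?C. (\<Sum>y\<in>cube j. g (x - y)) - S) / N j"
      using N[of j] by (simp only: norm_divide norm_of_real abs_of_pos)
    also have "cmod (\<Sum>x\<in>?C. (\<Sum>y\<in>cube j. g (x - y)) - S)
        \<le> (\<Sum>x\<in>?C. cmod ((\<Sum>y\<in>cube j. g (x - y)) - S))" by (rule norm_sum)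
    also have "\<dots> = (\<Sum>x\<in>?I. cmod ((\<Sum>y\<in>cube j. g (x - y)) - S))
        + (\<Sum>x\<in>?C - ?I. cmod ((\<Sum>y\<in>cube j. g (x - y)) - S))"
      using sum.subset_diff[OF sub finite_cube] by (simp add: add.commute)
    also have "\<dots> \<le> (\<Sum>x\<in>?I. tl r) + (\<Sum>x\<in>?C - ?I. T)"
      by (intro add_mono sum_mono near far)
    also have "\<dots> = N (j - r) * tl r + (N j - N (j - r)) * T"
      using sub by (simp add: N_def card_Diff_subset finite_cube of_nat_diff card_mono)
    also have "\<dots> \<le> N j * tl r + (N j - N (j - r)) * T"
      using tlr sub by (intro add_right_mono mult_right_mono) (auto simp: N_def card_mono finite_cube)
    finally have "cmod ((\<Sum>x\<in>?C. \<Sum>y\<in>cube j. g (x - y)) / of_nat (card ?C) - S)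
        \<le> (N j * tl r + (N j - N (j - r)) * T) / N j"
      using N[of j] by (simp add: divide_right_mono)
    also have "\<dots> = tl r + T * (1 - N (j - r) / N j)"
      using N[of j] by (simp add: field_simps)
    also have "\<dots> < e / 2 + e / 2" using j by (intro add_strict_mono r J) simp
    finally show ?thesis by simp
  qed
  then show "\<exists>no. \<forall>j\<ge>no. cmod ((\<Sum>x\<in>cube j. \<Sum>y\<in>cube j. g (x - y)) / of_nat (card (cube j :: (int^'d) set)) - infsum g UNIV) < e"
    unfolding S_def by blast
qed

section \<open>Diagonal sequences and finite-dimensional subspaces\<close>

text \<open>Take for \<open>m i\<close> the largest \<open>m\<close> with
  \<open>m + N m <= i\<close>: the summand \<open>N m\<close> secures \<open>P m i\<close>, and the
  summand \<open>m\<close> keeps the set of candidates finite.\<close>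

lemma slow_diagonal:
  fixes P :: "nat \<Rightarrow> nat \<Rightarrow> bool"
  assumes "\<And>m. eventually (P m) sequentially"
  obtains m where "filterlim m at_top sequentially" "\<forall>\<^sub>F i in sequentially. P (m i) i"
proof -
  obtain N where N: "\<And>m i. i \<ge> N m \<Longrightarrow> P m i"
    using assms unfolding eventually_sequentially by metis
  define L where "L m = m + N m" for m
  define S where "S i = {m. L m \<le> i}" for i
  have fin: "finite (S i)" for i
    by (rule finite_subset[of _ "{..i}"]) (auto simp: S_def L_def)
  define m where "m i = Max (S i)" for i
  have large: "M \<le> m i" if "i \<ge> L M" for M i
    unfolding m_def using that by (intro Max_ge fin) (simp add: S_def)
  have "filterlim m at_top sequentially"
    unfolding filterlim_at_top eventually_sequentially using large by blast
  \<comment> \<open>Below \<open>L 0\<close> the set \<open>S i\<close> may be empty and its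
    \<open>Max\<close> meaningless.\<close>
  moreover have "P (m i) i" if "i \<ge> L 0" for i
  proof -
    have "m i \<in> S i" unfolding m_def using that by (intro Max_in fin) (auto simp: S_def)
    then show ?thesis using N by (simp add: S_def L_def)
  qed
  then have "\<forall>\<^sub>F i in sequentially. P (m i) i"
    unfolding eventually_sequentially by blast
  ultimately show ?thesis using that by blast
qed

text \<open>Induction on the generators. The distance \<open>d\<close> of a new generator
  \<open>x\<close> from the closed smaller span is positive and controls its coefficient,
  \<open>\<bar>c\<bar> * d <= norm (c *\<^sub>R x + y)\<close>. Along a convergent sequence the
  coefficients are thus Cauchy and the remainders converge in the smaller span.\<close>

lemma closed_span_finite:
  fixes S :: "'a::real_normed_vector set"
  assumes "finite S"
  shows "closed (span S)"
  using assms
proof (induction S rule: finite_induct)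
  case empty
  then show ?case by simp
next
  case (insert x S)
  show ?case
  proof (cases "x \<in> span S")
    case True
    then show ?thesis using insert.IH by (simp add: span_redundant)
  next
    case False
    define d where "d = infdist x (span S)"
    have ne: "span S \<noteq> {}" using span_zero by blast
    have d: "0 < d"
      using False insert.IH ne by (simp add: d_def infdist_pos_not_in_closed)
    have low: "\<bar>c\<bar> * d \<le> norm (c *\<^sub>R x + y)" if y: "y \<in> span S" for c y
    proof (cases "c = 0")
      case False
      have "d \<le> dist x (- (1 / c) *\<^sub>R y)"
        unfolding d_def by (intro infdist_le span_scale y)
      also have "\<dots> = norm (x + (1 / c) *\<^sub>R y)" by (simp add: dist_norm)
      finally have "\<bar>c\<bar> * d \<le> norm (c *\<^sub>R (x + (1 / c) *\<^sub>R y))"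
        by (simp add: mult_left_mono)
      then show ?thesis using False by (simp add: scaleR_right_distrib)
    qed simp
    show ?thesis
      unfolding closed_sequential_limits
    proof (intro allI impI)
      fix u l assume u: "(\<forall>n. u n \<in> span (insert x S)) \<and> u \<longlonglongrightarrow> l"
      then have "\<exists>c. u n - c *\<^sub>R x \<in> span S" for n
        by (simp add: span_breakdown_eq)
      then obtain c where c: "\<And>n. u n - c n *\<^sub>R x \<in> span S" by metis
      have "Cauchy c"
      proof (rule metric_CauchyI)
        fix e :: real assume "0 < e"
        then have "0 < e * d" using d by simp
        moreover have "Cauchy u" by (rule LIMSEQ_imp_Cauchy[OF conjunct2[OF u]])
        ultimately obtain M where M: "\<And>m n. m \<ge> M \<Longrightarrow> n \<ge> M \<Longrightarrow> dist (u m) (u n) < e * d"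
          unfolding Cauchy_def by blast
        have "dist (c m) (c n) < e" if "m \<ge> M" "n \<ge> M" for m n
        proof -
          have "\<bar>c m - c n\<bar> * d \<le> norm ((c m - c n) *\<^sub>R x + ((u m - c m *\<^sub>R x) - (u n - c n *\<^sub>R x)))"
            by (intro low span_diff c)
          also have "\<dots> = dist (u m) (u n)" by (simp add: dist_norm algebra_simps)
          also have "\<dots> < e * d" using M that by blast
          finally show ?thesis using d by (simp add: dist_real_def)
        qed
        then show "\<exists>M. \<forall>m\<ge>M. \<forall>n\<ge>M. dist (c m) (c n) < e" by blast
      qed
      then obtain k where k: "c \<longlonglongrightarrow> k" by (metis Cauchy_convergent convergent_def)
      have "(\<lambda>n. u n - c n *\<^sub>R x) \<longlonglongrightarrow> l - k *\<^sub>R x"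
        using u k by (intro tendsto_diff tendsto_scaleR tendsto_const) auto
      then have "l - k *\<^sub>R x \<in> span S"
        using closed_sequentially[OF insert.IH, of "\<lambda>n. u n - c n *\<^sub>R x"] c by blast
      then show "l \<in> span (insert x S)" unfolding span_breakdown_eq by blast
    qed
  qed
qed

text \<open>The same distance \<open>d\<close>, positive because the smaller span is closed, bounds
  the coefficient of the new generator by \<open>norm v / d\<close>.\<close>

lemma linear_bounded_on_span_finite:
  fixes T :: "'a::real_normed_vector \<Rightarrow> 'b::real_normed_vector"
  assumes "finite S" and T: "linear T"
  shows "\<exists>K\<ge>0. \<forall>v\<in>span S. norm (T v) \<le> K * norm v"
  using assms(1)
proof (induction S rule: finite_induct)
  case empty
  then show ?case using T by (auto simp: linear_0)
next
  case (insert x S)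
  then obtain K where K: "K \<ge> 0" "\<And>v. v \<in> span S \<Longrightarrow> norm (T v) \<le> K * norm v" by blast
  show ?case
  proof (cases "x \<in> span S")
    case True
    then show ?thesis using K by (auto simp: span_redundant)
  next
    case False
    define d where "d = infdist x (span S)"
    have ne: "span S \<noteq> {}" using span_zero by blast
    have d: "0 < d"
      using False closed_span_finite[OF insert.hyps(1)] ne by (simp add: d_def infdist_pos_not_in_closed)
    \<comment> \<open>Collects \<open>\<bar>c\<bar> * norm (T x)\<close> and
      \<open>K * (norm v + \<bar>c\<bar> * norm x)\<close> after inserting
      \<open>\<bar>c\<bar> <= norm v / d\<close>.\<close>
    define K' where "K' = norm (T x) / d + K * (1 + norm x / d)"
    have "norm (T v) \<le> K' * norm v" if v: "v \<in> span (insert x S)" for v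
    proof -
      obtain c where c: "v - c *\<^sub>R x \<in> span S" using v unfolding span_breakdown_eq by blast
      have low: "\<bar>c\<bar> \<le> norm v / d"
      proof (cases "c = 0")
        case True
        then show ?thesis using d by simp
      next
        case False
        have "d \<le> dist x (- (1 / c) *\<^sub>R (v - c *\<^sub>R x))"
          unfolding d_def by (intro infdist_le span_scale c)
        also have "\<dots> = norm ((1 / c) *\<^sub>R v)"
          using False by (simp add: dist_norm scaleR_right_diff_distrib)
        also have "\<dots> = norm v / \<bar>c\<bar>" by simp
        finally show ?thesis using False d by (simp add: field_simps)
      qed
      have "norm (T v) = norm (c *\<^sub>R T x + T (v - c *\<^sub>R x))"
        using T by (simp add: linear_diff linear_scale)
      also have "\<dots> \<le> norm (c *\<^sub>R T x) + norm (T (v - c *\<^sub>R x))" by (rule norm_triangle_ineq)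
      also have "\<dots> \<le> \<bar>c\<bar> * norm (T x) + K * norm (v - c *\<^sub>R x)"
        using K(2)[OF c] by simp
      also have "\<dots> \<le> \<bar>c\<bar> * norm (T x) + K * (norm v + \<bar>c\<bar> * norm x)"
        using K(1) norm_triangle_ineq4[of v "c *\<^sub>R x"] by (simp add: mult_left_mono)
      also have "\<dots> \<le> (norm v / d) * norm (T x) + K * (norm v + (norm v / d) * norm x)"
        using low K(1) by (intro add_mono mult_right_mono mult_left_mono) auto
      also have "\<dots> = K' * norm v" by (simp add: K'_def algebra_simps)
      finally show ?thesis .
    qed
    moreover have "0 \<le> K'" using d K(1) by (simp add: K'_def)
    ultimately show ?thesis by blast
  qed
qed

section \<open>Clustering states\<close>

lemma cscale_alt: "cscale ii c a = Re c *\<^sub>R a + Im c *\<^sub>R (ii * a)"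
  by (simp add: cscale_def algebra_simps scaleR_conv_of_real)

locale clustering =
  fixes star :: "'a::{real_normed_algebra_1,banach} \<Rightarrow> 'a"
    and ii :: 'a
    and Oloc :: "(int^'d) set \<Rightarrow> 'a set"
    and iota :: "int^'d \<Rightarrow> 'a \<Rightarrow> 'a"
    and \<omega> :: "'a \<Rightarrow> complex"
  assumes clustering: "clustering_state star ii Oloc iota \<omega>"
begin

abbreviation sc :: "complex \<Rightarrow> 'a \<Rightarrow> 'a" where "sc \<equiv> cscale ii"
abbreviation Ob :: "'a set" where "Ob \<equiv> Obs Oloc"

lemma quasilocal: "quasilocal_setup star ii Oloc iota"
  and inv_state: "trans_inv_state star ii iota \<omega>"
  using clustering by (simp_all add: clustering_state_def)

lemma cstar: "unital_cstar_algebra star ii"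
  using quasilocal by (simp add: quasilocal_setup_def)

lemma star_add: "star (a + b) = star a + star b"
  and star_sc: "star (sc c a) = sc (cnj c) (star a)"
  and star_mult: "star (a * b) = star b * star a"
  and star_star: "star (star a) = a"
  and norm_star_mult: "norm (star a * a) = (norm a)\<^sup>2"
  and ii_central: "ii * a = a * ii"
  using cstar by (simp_all add: unital_cstar_algebra_def)

lemma om_add: "\<omega> (a + b) = \<omega> a + \<omega> b"
  and om_sc: "\<omega> (sc c a) = c * \<omega> a"
  and om_real: "Im (\<omega> (star a * a)) = 0"
  and om_pos: "Re (\<omega> (star a * a)) \<ge> 0"
  and om_one: "\<omega> 1 = 1"
  and om_iota: "\<omega> (iota x a) = \<omega> a"
  using inv_state by (simp_all add: trans_inv_state_def)

lemma iota_add: "iota x (a + b) = iota x a + iota x b"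
  and iota_sc: "iota x (sc c a) = sc c (iota x a)"
  and iota_mult: "iota x (a * b) = iota x a * iota x b"
  and iota_one: "iota x 1 = 1"
  and iota_star: "iota x (star a) = star (iota x a)"
  and iota_iota: "iota x (iota y a) = iota (x + y) a"
  and iota_Obs: "a \<in> Ob \<Longrightarrow> iota x a \<in> Ob"
  and supp_iota: "a \<in> Ob \<Longrightarrow> supp Oloc (iota x a) = (\<lambda>y. y + x) ` supp Oloc a"
  and bij_iota: "bij (iota x)"
  using quasilocal by (simp_all add: quasilocal_setup_def)

lemma Oloc_subalg: "finite X \<Longrightarrow> cstar_subalg star ii (Oloc X)"
  and Oloc_findim: "finite X \<Longrightarrow> \<exists>S. finite S \<and> S \<subseteq> Oloc X \<and> Oloc X = cspan_fin ii S"
  and Oloc_empty: "Oloc {} = {cscale ii c 1 | c. True}"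
  and Oloc_mono: "\<lbrakk>finite Y; X \<subseteq> Y\<rbrakk> \<Longrightarrow> Oloc X \<subseteq> Oloc Y"
  and Oloc_Int: "\<lbrakk>finite X; finite Y\<rbrakk> \<Longrightarrow> Oloc X \<inter> Oloc Y = Oloc (X \<inter> Y)"
  using quasilocal finite_subset[of X Y] by (simp_all add: quasilocal_setup_def)

lemma Oloc_zero: "finite X \<Longrightarrow> 0 \<in> Oloc X"
  and Oloc_add: "\<lbrakk>finite X; a \<in> Oloc X; b \<in> Oloc X\<rbrakk> \<Longrightarrow> a + b \<in> Oloc X"
  and Oloc_mult: "\<lbrakk>finite X; a \<in> Oloc X; b \<in> Oloc X\<rbrakk> \<Longrightarrow> a * b \<in> Oloc X"
  and Oloc_sc: "\<lbrakk>finite X; a \<in> Oloc X\<rbrakk> \<Longrightarrow> sc c a \<in> Oloc X"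
  and Oloc_star: "\<lbrakk>finite X; a \<in> Oloc X\<rbrakk> \<Longrightarrow> star a \<in> Oloc X"
  and Oloc_one: "finite X \<Longrightarrow> 1 \<in> Oloc X"
  using Oloc_subalg[of X] by (simp_all add: cstar_subalg_def)

lemma Oloc_sum: "finite X \<Longrightarrow> (\<And>i. i \<in> I \<Longrightarrow> h i \<in> Oloc X) \<Longrightarrow> sum h I \<in> Oloc X"
  by (induction I rule: infinite_finite_induct) (auto simp: Oloc_zero Oloc_add)

lemma ObI: "finite X \<Longrightarrow> a \<in> Oloc X \<Longrightarrow> a \<in> Ob"
  by (auto simp: Obs_def)

lemma ObE:
  assumes "a \<in> Ob" obtains r :: nat where "a \<in> Oloc (lball (real r))"
proof -
  obtain X where X: "finite X" "a \<in> Oloc X" using assms by (auto simp: Obs_def)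
  obtain r where "X \<subseteq> lball (real r)" using finite_subset_lball[OF X(1)] by blast
  then have "a \<in> Oloc (lball (real r))" using Oloc_mono[OF finite_lball] X(2) by blast
  then show ?thesis using that by blast
qed

lemma lball_mono: "r \<le> s \<Longrightarrow> lball r \<subseteq> lball s"
  by (auto simp: lball_def)

lemma Oloc_lball_mono: "r \<le> s \<Longrightarrow> a \<in> Oloc (lball r) \<Longrightarrow> a \<in> Oloc (lball s)"
  using Oloc_mono[OF finite_lball lball_mono] by blast

lemma Ob_add: "a \<in> Ob \<Longrightarrow> b \<in> Ob \<Longrightarrow> a + b \<in> Ob"
proof -
  assume "a \<in> Ob" "b \<in> Ob"
  then obtain r s :: nat where "a \<in> Oloc (lball (real r))" "b \<in> Oloc (lball (real s))"
    by (metis ObE)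
  then have "a \<in> Oloc (lball (real (max r s)))" "b \<in> Oloc (lball (real (max r s)))"
    by (auto intro: Oloc_lball_mono[rotated])
  then show ?thesis using Oloc_add ObI finite_lball by blast
qed

lemma Ob_zero: "0 \<in> Ob" using ObI[of "{}"] Oloc_zero by blast
lemma Ob_sc: "a \<in> Ob \<Longrightarrow> sc c a \<in> Ob" by (metis ObE ObI finite_lball Oloc_sc)
lemma Ob_star: "a \<in> Ob \<Longrightarrow> star a \<in> Ob" by (metis ObE ObI finite_lball Oloc_star)

section \<open>Scalars, the involution and linearity\<close>

lemma sc_one: "sc 1 a = a" by (simp add: cscale_alt)
lemma sc_neg: "sc (- 1) a = - a" by (simp add: cscale_alt)
lemma sc_of_real: "sc (complex_of_real r) a = r *\<^sub>R a" by (simp add: cscale_alt)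
lemma sc_mult_left: "sc c a * b = sc c (a * b)" by (simp add: cscale_def mult.assoc)
lemma sc_mult_right: "a * sc c b = sc c (a * b)"
proof -
  have "a * (ii * b) = ii * (a * b)" by (metis ii_central mult.assoc)
  then show ?thesis by (simp add: cscale_alt distrib_left)
qed

lemma star_one: "star 1 = 1"
  by (metis mult.right_neutral star_mult star_star)

lemma star_neg: "star (- a) = - star a"
  by (metis complex_cnj_minus complex_cnj_one sc_neg star_sc)

lemma star_diff: "star (a - b) = star a - star b"
  using star_add[of a "- b"] by (simp add: star_neg)

lemma star_zero: "star 0 = 0"
  using star_diff[of 0 0] by simp

lemma star_sum: "star (sum h I) = (\<Sum>i\<in>I. star (h i))"
  by (induction I rule: infinite_finite_induct) (simp_all add: star_zero star_add)

lemma om_neg: "\<omega> (- a) = - \<omega> a"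
  using om_sc[of "-1" a] by (simp add: sc_neg)

lemma om_diff: "\<omega> (a - b) = \<omega> a - \<omega> b"
  using om_add[of a "- b"] by (simp add: om_neg)

lemma linear_om: "linear \<omega>"
proof (rule linearI)
  show "\<omega> (r *\<^sub>R a) = r *\<^sub>R \<omega> a" for r a
    using om_sc[of "complex_of_real r" a] unfolding sc_of_real by (simp add: scaleR_conv_of_real)
qed (rule om_add)

lemma linear_iota: "linear (iota x)"
proof (rule linearI)
  show "iota x (r *\<^sub>R a) = r *\<^sub>R iota x a" for r a
    using iota_sc[of x "complex_of_real r" a] unfolding sc_of_real .
qed (rule iota_add)

text \<open>Idempotent by the group law and surjective, hence the identity.\<close>

lemma iota_zero [simp]: "iota 0 a = a"
proof -
  obtain b where "a = iota 0 b" using bij_iota[of 0] by (metis bij_pointE)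
  then show ?thesis by (simp add: iota_iota)
qed

text \<open>Polarisation against the unit: reality of the state at
  \<open>star (a + c) * (a + c)\<close> for the scalars \<open>c = 1\<close> and
  \<open>c = \<i>\<close> fixes the imaginary and the real part.\<close>

lemma om_star: "\<omega> (star a) = cnj (\<omega> a)"
proof -
  have ex: "\<omega> (star (a + sc c 1) * (a + sc c 1)) = \<omega> (star a * a) + c * \<omega> (star a) + cnj c * \<omega> a + cnj c * c" for c
    by (simp add: star_add star_sc star_one distrib_left distrib_right sc_mult_left sc_mult_right om_add om_sc om_one)
  have "Im (\<omega> (star a)) = - Im (\<omega> a)"
    using om_real[of "a + sc 1 1"] om_real[of a] by (simp add: ex)
  moreover have "Re (\<omega> (star a)) = Re (\<omega> a)"
    using om_real[of "a + sc \<i> 1"] om_real[of a] by (simp add: ex)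
  ultimately show ?thesis by (simp add: complex_eq_iff)
qed

section \<open>The covariance form of the state\<close>

definition e :: "'a \<Rightarrow> 'a \<Rightarrow> complex" where
  "e a b = \<omega> (star a * b) - \<omega> (star a) * \<omega> b"

lemma e_add_right: "e a (b + c) = e a b + e a c"
  by (simp add: e_def distrib_left om_add algebra_simps)

lemma e_sc_right: "e a (sc z b) = z * e a b"
  by (simp add: e_def sc_mult_right om_sc algebra_simps)

lemma e_herm: "e b a = cnj (e a b)"
  using om_star[of "star a * b"] by (simp add: e_def star_mult star_star om_star)

lemma e_one_right: "e a 1 = 0"
  by (simp add: e_def om_one)

text \<open>Centring one factor already produces the covariance, so the conditions defining a
  pseudolocal sequence become statements about \<open>e (Q n)\<close>.\<close>

lemma om_centred: "\<omega> (star (centred ii \<omega> q) * a) = e q a"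
  by (simp add: e_def centred_def star_diff star_sc star_one left_diff_distrib om_diff sc_mult_left om_sc om_star)

lemma om_centred_self: "\<omega> (star (centred ii \<omega> q) * centred ii \<omega> q) = e q q"
proof -
  have "e q (q + sc (- \<omega> q) 1) = e q q"
    unfolding e_add_right e_sc_right by (simp add: e_one_right)
  moreover have "centred ii \<omega> q = q + sc (- \<omega> q) 1"
    by (simp add: centred_def cscale_def algebra_simps)
  ultimately show ?thesis unfolding om_centred by metis
qed

text \<open>Positivity of the covariance is positivity of the state at the centred element.\<close>

sublocale E: psd_form UNIV sc e
  by unfold_locales
    (auto simp: sc_one sc_neg e_add_right e_sc_right intro: e_herm om_pos[of "centred ii \<omega> a" for a, unfolded om_centred_self])

lemma e_sum_left: "e (sum h I) b = (\<Sum>i\<in>I. e (h i) b)"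
  by (induction I rule: infinite_finite_induct)
    (simp_all add: E.B_add_left, simp_all add: e_def star_zero om_diff[of 0 0, simplified])

lemma e_sum_right: "e a (sum h I) = (\<Sum>i\<in>I. e a (h i))"
  by (induction I rule: infinite_finite_induct)
    (simp_all add: e_add_right, simp_all add: e_def om_diff[of 0 0, simplified])

lemma e_iota: "e (iota x a) (iota x b) = e a b"
  by (simp add: e_def iota_star[symmetric] iota_mult[symmetric] om_iota)

lemma e_iota_iota: "e (iota x a) (iota y b) = e (iota (x - y) a) b"
  using e_iota[of y "iota (x - y) a" b] by (simp add: iota_iota)

section \<open>Supports and maps on local algebras\<close>

lemma supp_finite: "a \<in> Ob \<Longrightarrow> finite (supp Oloc a)"
  and Oloc_supp: "a \<in> Ob \<Longrightarrow> a \<in> Oloc (supp Oloc a)"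
proof -
  assume "a \<in> Ob"
  then obtain X0 where "finite X0 \<and> a \<in> Oloc X0" by (auto simp: Obs_def)
  \<comment> \<open>The intersection axiom is binary while \<open>supp\<close> intersects infinitely
    many sets. A localising set of least cardinality cannot shrink when intersected with another
    one, so it lies inside all of them.\<close>
  from ex_has_least_nat[of "\<lambda>X. finite X \<and> a \<in> Oloc X", OF this, of card]
  obtain X where X: "finite X" "a \<in> Oloc X"
    and min: "\<And>Y. finite Y \<and> a \<in> Oloc Y \<Longrightarrow> card X \<le> card Y"
    by auto
  have "X \<subseteq> Y" if Y: "finite Y" "a \<in> Oloc Y" for Y
  proof -
    have "a \<in> Oloc (X \<inter> Y)" using X Y Oloc_Int[OF X(1) Y(1)] by auto
    then have "card X \<le> card (X \<inter> Y)" using min[of "X \<inter> Y"] X by simp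
    then have "X \<inter> Y = X" using X(1) by (intro card_seteq) auto
    then show ?thesis by auto
  qed
  then have "supp Oloc a = X"
    unfolding supp_def using X by (intro equalityI Inter_lower Inter_greatest) auto
  then show "finite (supp Oloc a)" "a \<in> Oloc (supp Oloc a)" using X by auto
qed

lemma supp_subset: "finite X \<Longrightarrow> a \<in> Oloc X \<Longrightarrow> supp Oloc a \<subseteq> X"
  unfolding supp_def by (rule Inter_lower) simp

text \<open>The setup says how supports move; covariance of the local algebras follows because an
  observable lies in the algebra of its own support.\<close>

lemma Oloc_iota:
  assumes X: "finite X" and a: "a \<in> Oloc X"
  shows "iota x a \<in> Oloc ((\<lambda>y. y + x) ` X)"
proof -
  have Ob: "a \<in> Ob" using X a by (rule ObI)
  have "iota x a \<in> Oloc ((\<lambda>y. y + x) ` supp Oloc a)"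
    using Oloc_supp[OF iota_Obs[OF Ob], of x] by (simp add: supp_iota[OF Ob])
  then show ?thesis
    by (rule subsetD[OF Oloc_mono[OF finite_imageI[OF X] image_mono[OF supp_subset[OF X a]]]])
qed

text \<open>Complex generators \<open>S\<close> give the real generators \<open>S\<close> and
  \<open>ii * S\<close>, so real-linear maps are bounded on each local algebra. This supplies local
  continuity of the state and of translations.\<close>

lemma linear_bounded_on_Oloc:
  fixes T :: "'a \<Rightarrow> 'b::real_normed_vector"
  assumes X: "finite X" and T: "linear T"
  shows "\<exists>K\<ge>0. \<forall>v\<in>Oloc X. norm (T v) \<le> K * norm v"
proof -
  obtain S where S: "finite S" "Oloc X = cspan_fin ii S" using Oloc_findim[OF X] by blast
  have "Oloc X \<subseteq> span (S \<union> (*) ii ` S)"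
  proof
    fix v assume "v \<in> Oloc X"
    then obtain c where v: "v = (\<Sum>s\<in>S. sc (c s) s)" using S by (auto simp: cspan_fin_def)
    show "v \<in> span (S \<union> (*) ii ` S)"
      unfolding v cscale_alt
      by (intro span_sum span_add span_scale span_base) auto
  qed
  then show ?thesis
    using linear_bounded_on_span_finite[of "S \<union> (*) ii ` S" T] S(1) T by blast
qed

section \<open>Contractivity of translations on local observables\<close>

lemma norm_star: "norm (star a) = norm a"
proof -
  have le: "norm a \<le> norm (star a)" for a
  proof -
    have "norm a * norm a \<le> norm (star a) * norm a"
      using norm_mult_ineq[of "star a" a] by (simp add: norm_star_mult power2_eq_square)
    then show ?thesis
      by (cases "norm a = 0") (auto simp: mult_le_cancel_right)
  qed
  from le[of a] le[of "star a"] show ?thesis by (simp add: star_star)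
qed

lemma star_power: "star (a ^ k) = star a ^ k"
proof (induction k)
  case (Suc k)
  then show ?case unfolding power_Suc star_mult by (simp add: power_commutes)
qed (simp add: star_one)

text \<open>Each use of the C*-identity doubles the exponent, hence powers of two.\<close>

lemma norm_power_selfadjoint:
  assumes "star h = h"
  shows "norm (h ^ (2 ^ n)) = norm h ^ (2 ^ n)"
proof (induction n)
  case (Suc n)
  have "norm (h ^ (2 ^ Suc n)) = norm (star (h ^ (2 ^ n)) * h ^ (2 ^ n))"
    by (simp add: star_power assms power_add[symmetric] mult_2)
  also have "\<dots> = (norm h ^ (2 ^ n))\<^sup>2" by (simp only: norm_star_mult Suc)
  finally show ?case by (simp add: power_mult[symmetric] mult.commute)
qed simp

lemma iota_power: "iota x (a ^ k) = iota x a ^ k"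
  by (induction k) (simp_all add: iota_one iota_mult)

lemma Oloc_power: "finite X \<Longrightarrow> a \<in> Oloc X \<Longrightarrow> a ^ k \<in> Oloc X"
  by (induction k) (simp_all add: Oloc_one Oloc_mult)

text \<open>On a finite-dimensional subalgebra \<open>iota x\<close> is bounded by some \<open>K\<close>; applying this to the
  powers \<open>h ^ (2 ^ n)\<close> of a self-adjoint \<open>h\<close> removes the constant.\<close>

lemma norm_iota_le:
  assumes a: "a \<in> Ob"
  shows "norm (iota x a) \<le> norm a"
proof -
  have sa: "norm (iota x h) \<le> norm h" if h: "h \<in> Ob" "star h = h" for h
  proof (rule ccontr)
    assume "\<not> norm (iota x h) \<le> norm h"
    then have gt: "norm h < norm (iota x h)" by simp
    obtain r :: nat where r: "h \<in> Oloc (lball (real r))" by (rule ObE[OF h(1)])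
    obtain K where K: "K \<ge> 0" "\<And>v. v \<in> Oloc (lball (real r)) \<Longrightarrow> norm (iota x v) \<le> K * norm v"
      using linear_bounded_on_Oloc[OF finite_lball[of "real r"] linear_iota[of x]] by auto
    have bd: "norm (iota x h) ^ (2 ^ n) \<le> K * norm h ^ (2 ^ n)" for n
    proof -
      have "star (iota x h) = iota x h" using iota_star[of x h] h(2) by simp
      then have "norm (iota x h) ^ (2 ^ n) = norm (iota x (h ^ (2 ^ n)))"
        by (simp add: norm_power_selfadjoint iota_power)
      also have "\<dots> \<le> K * norm (h ^ (2 ^ n))"
        by (rule K(2)[OF Oloc_power[OF finite_lball r]])
      finally show ?thesis using h by (simp add: norm_power_selfadjoint)
    qed
    show False
    proof (cases "norm h = 0")
      case True
      then show ?thesis using bd[of 0] gt by simp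
    next
      case False
      then have hp: "0 < norm h" by simp
      define t where "t = norm (iota x h) / norm h"
      have t: "1 < t" using gt hp by (simp add: t_def)
      obtain n where n: "K < t ^ n" using real_arch_pow[OF t] by blast
      have "t ^ n \<le> t ^ (2 ^ n)" using t less_exp[of n] by (intro power_increasing) (simp_all add: less_imp_le)
      also have "\<dots> \<le> K"
        using bd[of n] hp by (simp add: t_def power_divide divide_le_eq)
      finally show ?thesis using n by simp
    qed
  qed
  obtain r :: nat where r: "a \<in> Oloc (lball (real r))" by (rule ObE[OF a])
  \<comment> \<open>The C*-identity reduces a general \<open>a\<close> to the self-adjoint element
    \<open>star a * a\<close>.\<close>
  have "star a * a \<in> Ob"
    by (rule ObI[OF finite_lball Oloc_mult[OF finite_lball Oloc_star[OF finite_lball r] r]])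
  moreover have "star (star a * a) = star a * a" by (simp add: star_mult star_star)
  ultimately have "norm (iota x (star a * a)) \<le> norm (star a * a)" by (rule sa)
  then have "(norm (iota x a))\<^sup>2 \<le> (norm a)\<^sup>2"
    by (simp only: iota_mult iota_star norm_star_mult)
  then show ?thesis by (rule power2_le_imp_le) simp
qed

section \<open>Decay of truncated correlations\<close>

lemma om_bounded_on_Oloc: "finite X \<Longrightarrow> \<exists>K\<ge>0. \<forall>v\<in>Oloc X. cmod (\<omega> v) \<le> K * norm v"
  by (rule linear_bounded_on_Oloc[OF _ linear_om])

text \<open>The clustering estimate concerns nonempty supports. An observable with empty support is
  a scalar, and its covariances vanish.\<close>

lemma e_scalar_left:
  assumes "star a = sc c 1"
  shows "e (iota z a) b = 0"
  using assms
  by (simp add: e_def iota_star[symmetric] iota_sc iota_one sc_mult_left om_sc om_one)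

lemma e_scalar_right: "e a (sc c 1) = 0"
  by (simp add: e_sc_right e_one_right)

lemma e_self_le: "Re (e a a) \<le> cmod (\<omega> (star a * a))"
proof -
  have "\<omega> (star a) * \<omega> a = complex_of_real ((cmod (\<omega> a))\<^sup>2)"
    using complex_norm_square[of "\<omega> a"] by (simp add: om_star mult.commute)
  then have "Re (e a a) \<le> Re (\<omega> (star a * a))" by (simp add: e_def)
  then show ?thesis using complex_Re_le_cmod[of "\<omega> (star a * a)"] by linarith
qed

lemma sdist_iota_ge:
  assumes a: "a \<in> Oloc (lball (real r))" and b: "b \<in> Oloc (lball (real r))"
    and ne: "supp Oloc a \<noteq> {}" "supp Oloc b \<noteq> {}"
  shows "ldist z 0 - 2 * int r \<le> sdist Oloc (iota z a) b"
proof -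
  have Ob: "a \<in> Ob" "b \<in> Ob" using a b ObI[OF finite_lball] by auto
  have sub: "supp Oloc a \<subseteq> lball (real r)" "supp Oloc b \<subseteq> lball (real r)"
    using supp_subset[OF finite_lball] a b by auto
  have supz: "supp Oloc (iota z a) = (\<lambda>y. y + z) ` supp Oloc a" by (rule supp_iota[OF Ob(1)])
  let ?M = "{ldist x y | x y. x \<in> supp Oloc (iota z a) \<and> y \<in> supp Oloc b}"
  have "?M = (\<lambda>(x, y). ldist x y) ` (supp Oloc (iota z a) \<times> supp Oloc b)" by auto
  then have fin: "finite ?M" using supp_finite[OF Ob(1)] supp_finite[OF Ob(2)] by (simp add: supz)
  have "?M \<noteq> {}" using ne by (auto simp: supz)
  then have "sdist Oloc (iota z a) b \<in> ?M" unfolding sdist_def using fin by (intro Min_in)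
  then obtain x y where xy: "x \<in> supp Oloc a" "y \<in> supp Oloc b"
    "sdist Oloc (iota z a) b = ldist (x + z) y"
    unfolding supz by auto
  have "ldist x 0 \<le> int r" "ldist y 0 \<le> int r" using xy sub by (auto simp: lball_def)
  then show ?thesis using ldist_triangle3[of z y x] xy(3) by linarith
qed

text \<open>One summable majorant for all observables of given radius and norm. Near the origin
  Cauchy-Schwarz and local boundedness of the state suffice; farther out the supports are separated
  and clustering applies.\<close>

lemma cluster_bound:
  obtains p where "real CARD('d) < p"
    "\<And>(r::nat) (N::real). \<exists>K\<ge>0. \<forall>a\<in>Oloc (lball (real r)). \<forall>b\<in>Oloc (lball (real r)). norm a \<le> N \<longrightarrow> norm b \<le> N \<longrightarrow>
       (\<forall>z. cmod (e (iota z a) b) \<le> K * (1 + real_of_int (ldist z 0)) powr (- p))"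
proof -
  obtain \<nu> :: "nat \<Rightarrow> real" and f :: "int \<Rightarrow> real" and p :: real where
    nu: "\<And>l. \<nu> l \<ge> 0" and f: "\<And>d. f d \<ge> 0" and p: "real CARD('d) < p"
    and fp: "\<And>d. d > 0 \<Longrightarrow> f d \<le> real_of_int d powr (- p)"
    and cl: "\<And>l a b. \<lbrakk>a \<in> Ob; b \<in> Ob; supp Oloc a \<noteq> {}; supp Oloc b \<noteq> {}; card (supp Oloc a) < l; card (supp Oloc b) < l\<rbrakk>
      \<Longrightarrow> cmod (\<omega> (a * b) - \<omega> a * \<omega> b) \<le> \<nu> l * norm a * norm b * f (sdist Oloc a b)"
    using clustering unfolding clustering_state_def by blast
  have p0: "0 < p" using p by (meson of_nat_0_le_iff order_le_less_trans)
  have "\<exists>K\<ge>0. \<forall>a\<in>Oloc (lball (real r)). \<forall>b\<in>Oloc (lball (real r)). norm a \<le> N \<longrightarrow> norm b \<le> N \<longrightarrow>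
       (\<forall>z. cmod (e (iota z a) b) \<le> K * (1 + real_of_int (ldist z 0)) powr (- p))" for r :: nat and N :: real
  proof -
    let ?X = "lball (real r) :: (int^'d) set"
    let ?w = "\<lambda>z::int^'d. (1 + real_of_int (ldist z 0)) powr (- p)"
    obtain Ko where Ko: "Ko \<ge> 0" "\<And>v. v \<in> Oloc ?X \<Longrightarrow> cmod (\<omega> v) \<le> Ko * norm v"
      using om_bounded_on_Oloc[OF finite_lball[of "real r"]] by auto
    \<comment> \<open>Clustering asks for cardinalities strictly below \<open>l\<close>, hence the
      \<open>+ 1\<close>.\<close>
    define l where "l = card ?X + 1"
    \<comment> \<open>\<open>K1\<close> serves the far region, where the distance is at least half
      of \<open>1 + ldist z 0\<close>; \<open>K2\<close> serves the near one, where
      \<open>1 + ldist z 0 <= 4 * r + 2\<close>.\<close>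
    define K1 where "K1 = \<nu> l * N\<^sup>2 * 2 powr p"
    define K2 where "K2 = Ko * N\<^sup>2 * (4 * real r + 2) powr p"
    have K12: "0 \<le> K1" "0 \<le> K2" using nu Ko by (simp_all add: K1_def K2_def)
    have "cmod (e (iota z a) b) \<le> (K1 + K2) * ?w z"
      if a: "a \<in> Oloc ?X" and b: "b \<in> Oloc ?X" and na: "norm a \<le> N" and nb: "norm b \<le> N" for a b z
    proof -
      have N0: "0 \<le> N" using na norm_ge_zero order_trans by blast
      have Ob: "a \<in> Ob" "b \<in> Ob" "star a \<in> Ob" using a b ObI[OF finite_lball] Ob_star by auto
      have sa: "star a \<in> Oloc ?X" by (rule Oloc_star[OF finite_lball a])
      have z0: "0 \<le> ldist z 0" by (rule ldist_nonneg)
      then have zp: "0 < 1 + real_of_int (ldist z 0)" by (simp add: add_pos_nonneg)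
      show ?thesis
      proof (cases "ldist z 0 \<le> 4 * int r + 1")
        case True
        have self: "E.nrm v \<le> sqrt (Ko * N\<^sup>2)" if v: "v \<in> Oloc ?X" "norm v \<le> N" for v
        proof -
          have "Re (e v v) \<le> cmod (\<omega> (star v * v))" by (rule e_self_le)
          also have "\<dots> \<le> Ko * norm (star v * v)"
            by (rule Ko(2)[OF Oloc_mult[OF finite_lball Oloc_star[OF finite_lball v(1)] v(1)]])
          also have "\<dots> \<le> Ko * N\<^sup>2"
            using v(2) Ko(1) by (simp add: norm_star_mult mult_left_mono power_mono)
          finally show ?thesis unfolding E.nrm_def by (rule real_sqrt_le_mono)
        qed
        have "cmod (e (iota z a) b) \<le> E.nrm (iota z a) * E.nrm b" by (rule E.cauchy_schwarz) auto
        also have "E.nrm (iota z a) = E.nrm a" by (simp add: E.nrm_def e_iota)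
        also have "E.nrm a * E.nrm b \<le> sqrt (Ko * N\<^sup>2) * sqrt (Ko * N\<^sup>2)"
          using self[OF a na] self[OF b nb] Ko(1) by (intro mult_mono) (auto simp: E.nrm_ge_0)
        also have "\<dots> = Ko * N\<^sup>2" using Ko(1) by simp
        also have "\<dots> = K2 * (4 * real r + 2) powr (- p)"
          by (simp add: K2_def powr_minus_divide powr_add[symmetric])
        also have "\<dots> \<le> K2 * ?w z"
          using True zp p0 K12 by (intro mult_left_mono powr_mono2') auto
        also have "\<dots> \<le> (K1 + K2) * ?w z" using K12 by (intro mult_right_mono) auto
        finally show ?thesis .
      next
        case False
        show ?thesis
        proof (cases "supp Oloc (star a) = {} \<or> supp Oloc b = {}")
          case True
          then have "star a \<in> Oloc {} \<or> b \<in> Oloc {}"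
            using Oloc_supp[OF Ob(3)] Oloc_supp[OF Ob(2)] by auto
          then have "e (iota z a) b = 0"
            unfolding Oloc_empty by (auto simp: e_scalar_left e_scalar_right)
          then show ?thesis using K12 by simp
        next
          case ne: False
          define d where "d = sdist Oloc (iota z (star a)) b"
          have dge: "ldist z 0 - 2 * int r \<le> d"
            unfolding d_def using ne by (intro sdist_iota_ge sa b) auto
          have dpos: "0 < d" using dge False by linarith
          have half: "(1 + real_of_int (ldist z 0)) / 2 \<le> real_of_int d"
          proof -
            \<comment> \<open>Beyond \<open>4 * r + 1\<close>, the loss \<open>2 * r\<close> is less
              than half of \<open>ldist z 0\<close>.\<close>
            have "1 + ldist z 0 \<le> 2 * d" using dge False by linarith
            then have "real_of_int (1 + ldist z 0) \<le> real_of_int (2 * d)" by (simp only: of_int_le_iff)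
            then show ?thesis by simp
          qed
          have card: "card (supp Oloc v) < l" if "v \<in> Oloc ?X" for v
            using card_mono[OF finite_lball supp_subset[OF finite_lball that]] by (simp add: l_def)
          have cardz: "card (supp Oloc (iota z (star a))) < l"
            using card[OF sa] by (simp add: supp_iota[OF Ob(3)] card_image)
          have nez: "supp Oloc (iota z (star a)) \<noteq> {}" using ne by (simp add: supp_iota[OF Ob(3)])
          have "cmod (e (iota z a) b) = cmod (\<omega> (iota z (star a) * b) - \<omega> (iota z (star a)) * \<omega> b)"
            by (simp add: e_def iota_star)
          also have "\<dots> \<le> \<nu> l * norm (iota z (star a)) * norm b * f d"
            unfolding d_def by (rule cl[OF iota_Obs[OF Ob(3)] Ob(2) nez _ cardz card[OF b]]) (use ne in simp)
          also have "\<dots> \<le> \<nu> l * N * N * f d"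
            using norm_iota_le[OF Ob(3), of z] na nb nu f N0
            by (intro mult_right_mono mult_mono mult_left_mono) (auto simp: norm_star)
          also have "\<dots> \<le> \<nu> l * N * N * ((1 + real_of_int (ldist z 0)) / 2) powr (- p)"
          proof (intro mult_left_mono)
            have "f d \<le> real_of_int d powr (- p)" by (rule fp[OF dpos])
            also have "\<dots> \<le> ((1 + real_of_int (ldist z 0)) / 2) powr (- p)"
              using half zp p0 by (intro powr_mono2') auto
            finally show "f d \<le> ((1 + real_of_int (ldist z 0)) / 2) powr (- p)" .
          qed (use nu N0 in simp)
          also have "((1 + real_of_int (ldist z 0)) / 2) powr (- p) = ?w z * 2 powr p"
            using zp by (simp add: powr_divide powr_minus_divide)
          also have "\<nu> l * N * N * (?w z * 2 powr p) = K1 * ?w z"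
            by (simp add: K1_def power2_eq_square)
          also have "\<dots> \<le> (K1 + K2) * ?w z" using K12 by (intro mult_right_mono) auto
          finally show ?thesis .
        qed
      qed
    qed
    then show ?thesis using K12 by (intro exI[of _ "K1 + K2"]) auto
  qed
  then show ?thesis using that p by blast
qed

text \<open>The cutoff cube is chosen before the test observable \<open>a\<close>; the diagonal
  construction relies on this uniformity, since one sequence has to work for all observables. It
  comes from the common majorant.\<close>

lemma cluster_tail_uniform:
  assumes s: "s \<in> Ob"
  shows "0 < \<epsilon> \<Longrightarrow> \<forall>\<^sub>F j in sequentially. \<forall>a\<in>Oloc (lball (real r)). norm a \<le> N \<longrightarrow>
           infsum (\<lambda>z. cmod (e (iota z s) a)) (- cube j) \<le> \<epsilon>"
    and cluster_summable: "b \<in> Ob \<Longrightarrow> (\<lambda>z. cmod (e (iota z s) b)) summable_on UNIV"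
proof -
  obtain p where p: "real CARD('d) < p" and
    K: "\<And>(r::nat) (N::real). \<exists>K\<ge>0. \<forall>a\<in>Oloc (lball (real r)). \<forall>b\<in>Oloc (lball (real r)). norm a \<le> N \<longrightarrow> norm b \<le> N \<longrightarrow>
       (\<forall>z. cmod (e (iota z a) b) \<le> K * (1 + real_of_int (ldist z 0)) powr (- p))"
    using cluster_bound by metis
  define w where "w = (\<lambda>z::int^'d. (1 + real_of_int (ldist z 0)) powr (- p))"
  have w: "w summable_on UNIV" unfolding w_def by (rule summable_lattice_weight[OF p])
  obtain r0 :: nat where r0: "s \<in> Oloc (lball (real r0))" by (rule ObE[OF s])
  have bound: "\<exists>K\<ge>0. \<forall>a\<in>Oloc (lball (real r)). norm a \<le> N \<longrightarrow> (\<forall>z. cmod (e (iota z s) a) \<le> K * w z)" for r :: nat and N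
  proof -
    define r1 where "r1 = max r0 r"
    define N1 where "N1 = max (norm s) N"
    have s1: "s \<in> Oloc (lball (real r1))" by (rule Oloc_lball_mono[OF _ r0]) (simp add: r1_def)
    obtain K' where K': "K' \<ge> 0" and K'': "\<And>a b z. a\<in>Oloc (lball (real r1)) \<Longrightarrow> b\<in>Oloc (lball (real r1)) \<Longrightarrow>
       norm a \<le> N1 \<Longrightarrow> norm b \<le> N1 \<Longrightarrow> cmod (e (iota z a) b) \<le> K' * w z"
      using K[of r1 N1] unfolding w_def by auto
    have "cmod (e (iota z s) a) \<le> K' * w z" if "a \<in> Oloc (lball (real r))" "norm a \<le> N" for a z
    proof (rule K''[OF s1])
      show "a \<in> Oloc (lball (real r1))" by (rule Oloc_lball_mono[OF _ that(1)]) (simp add: r1_def)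
    qed (use that in \<open>auto simp: N1_def\<close>)
    then show ?thesis using K' by auto
  qed
  show sum: "(\<lambda>z. cmod (e (iota z s) b)) summable_on UNIV" if b: "b \<in> Ob" for b
  proof -
    obtain r :: nat where r: "b \<in> Oloc (lball (real r))" by (rule ObE[OF b])
    obtain K' where "\<And>z. cmod (e (iota z s) b) \<le> K' * w z"
      using bound[of r "norm b"] r by auto
    then show ?thesis
      by (intro summable_on_comparison_test[OF summable_on_cmult_right[OF w, of K']]) auto
  qed
  assume eps: "0 < \<epsilon>"
  obtain K' where K': "K' \<ge> 0" "\<And>a z. a \<in> Oloc (lball (real r)) \<Longrightarrow> norm a \<le> N \<Longrightarrow> cmod (e (iota z s) a) \<le> K' * w z"
    using bound[of r N] by auto
  have "(\<lambda>j. infsum (\<lambda>z. K' * w z) (- cube j)) \<longlonglongrightarrow> 0"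
    using K'(1) by (intro cube_tail_tendsto_0 summable_on_cmult_right w) (simp add: w_def)
  then have "\<forall>\<^sub>F j in sequentially. infsum (\<lambda>z. K' * w z) (- cube j) < \<epsilon>"
    using eps by (rule order_tendstoD(2))
  then show "\<forall>\<^sub>F j in sequentially. \<forall>a\<in>Oloc (lball (real r)). norm a \<le> N \<longrightarrow>
           infsum (\<lambda>z. cmod (e (iota z s) a)) (- cube j) \<le> \<epsilon>"
  proof (rule eventually_mono, intro ballI impI)
    fix j a
    assume j: "infsum (\<lambda>z. K' * w z) (- cube j) < \<epsilon>" and a: "a \<in> Oloc (lball (real r))" "norm a \<le> N"
    have "infsum (\<lambda>z. cmod (e (iota z s) a)) (- cube j) \<le> infsum (\<lambda>z. K' * w z) (- cube j)"
    proof (rule infsum_mono)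
      show "(\<lambda>z. cmod (e (iota z s) a)) summable_on - cube j"
        by (rule summable_on_subset_banach[OF sum[OF ObI[OF finite_lball a(1)]]]) simp
      show "(\<lambda>z. K' * w z) summable_on - cube j"
        by (rule summable_on_subset_banach[OF summable_on_cmult_right[OF w]]) simp
    qed (rule K'(2)[OF a])
    then show "infsum (\<lambda>z. cmod (e (iota z s) a)) (- cube j) \<le> \<epsilon>" using j by simp
  qed
qed

section \<open>The space-summed connected correlation\<close>

definition L :: "'a \<Rightarrow> 'a \<Rightarrow> complex" where
  "L a b = infsum (\<lambda>z. e (iota z a) b) UNIV"

lemma e_iota_summable: "a \<in> Ob \<Longrightarrow> b \<in> Ob \<Longrightarrow> (\<lambda>z. e (iota z a) b) summable_on UNIV"
  by (rule abs_summable_summable) (rule cluster_summable)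

text \<open>By translation invariance the double sum depends on \<open>x - y\<close> only, so
  \<open>L\<close> is the covariance of two box sums per unit volume in the limit.\<close>

lemma L_average:
  assumes "a \<in> Ob" "b \<in> Ob"
  shows "(\<lambda>j. e (\<Sum>x\<in>cube j. iota x a) (\<Sum>y\<in>cube j. iota y b) / of_nat (card (cube j :: (int^'d) set))) \<longlonglongrightarrow> L a b"
proof -
  have "e (\<Sum>x\<in>cube j. iota x a) (\<Sum>y\<in>cube j. iota y b) = (\<Sum>x\<in>cube j. \<Sum>y\<in>cube j. e (iota (x - y) a) b)" for j
    by (simp only: e_sum_left) (simp only: e_sum_right e_iota_iota)
  then show ?thesis
    using cube_average_tendsto_infsum[OF cluster_summable[OF assms]] by (simp add: L_def)
qed

text \<open>Translation invariance exchanges the two arguments at the price of the reflection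
  \<open>z\<close> to \<open>- z\<close>, a bijection of the lattice.\<close>

lemma L_herm: "L b a = cnj (L a b)"
proof -
  have "L b a = infsum (\<lambda>z. cnj (e (iota (- z) a) b)) UNIV"
    unfolding L_def
  proof (rule infsum_cong)
    fix z :: "int^'d"
    have "e (iota z b) a = cnj (e a (iota z b))" by (rule e_herm)
    also have "e a (iota z b) = e (iota (- z) a) b" using e_iota_iota[of 0 a z b] by simp
    finally show "e (iota z b) a = cnj (e (iota (- z) a) b)" .
  qed
  also have "\<dots> = cnj (infsum (\<lambda>z. e (iota (- z) a) b) UNIV)" by simp
  also have "infsum (\<lambda>z. e (iota (- z) a) b) UNIV = L a b"
    unfolding L_def by (rule infsum_reindex_bij_betw[of uminus UNIV UNIV "\<lambda>z. e (iota z a) b"])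
      (rule bij_betwI[of _ _ _ uminus], auto)
  finally show ?thesis .
qed

text \<open>The single terms have no sign; positivity is inherited from the variances of box
  sums.\<close>

lemma L_pos:
  assumes "a \<in> Ob"
  shows "0 \<le> Re (L a a)"
proof (rule LIMSEQ_le_const)
  show "(\<lambda>j. Re (e (\<Sum>x\<in>cube j. iota x a) (\<Sum>y\<in>cube j. iota y a) / of_nat (card (cube j :: (int^'d) set)))) \<longlonglongrightarrow> Re (L a a)"
    by (intro tendsto_Re L_average assms)
  have "0 \<le> Re (e (\<Sum>x\<in>cube j. iota x a) (\<Sum>y\<in>cube j. iota y a) / of_nat (card (cube j :: (int^'d) set)))" for j
    using E.B_pos[of "\<Sum>x\<in>cube j. iota x a"] by (simp add: Re_divide_of_nat)
  then show "\<exists>N. \<forall>n\<ge>N. 0 \<le> Re (e (\<Sum>x\<in>cube n. iota x a) (\<Sum>y\<in>cube n. iota y a) / of_nat (card (cube n :: (int^'d) set)))"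
    by blast
qed

sublocale L: psd_form Ob sc L
proof
  show "L a (b + c) = L a b + L a c" if "a \<in> Ob" "b \<in> Ob" "c \<in> Ob" for a b c
    unfolding L_def e_add_right by (rule infsum_add) (simp_all add: e_iota_summable that)
  show "L a (sc z b) = z * L a b" for a b z
    unfolding L_def e_sc_right by (rule infsum_cmult_right')
qed (auto simp: Ob_zero Ob_add Ob_sc sc_one sc_neg L_pos intro: L_herm)

section \<open>The symmetrised form and its two halves\<close>

lemma symmetrised_e:
  "\<omega> (star q * b + b * star q) / 2 - \<omega> (star q) * \<omega> b = (1/2) * (e q b + cnj (e (star q) (star b)))"
proof -
  \<comment> \<open>The reversed product \<open>b * star q\<close> is the covariance of
    \<open>star b\<close> with \<open>star q\<close>, that is, the conjugate of an ordinary
    covariance of the adjoints.\<close>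
  have herm: "cnj (e (star q) (star b)) = e (star b) (star q)" by (rule e_herm[symmetric])
  show ?thesis
    unfolding herm by (simp add: e_def star_star om_add field_simps)
qed

lemma hform_eq:
  assumes "a \<in> Ob" "b \<in> Ob"
  shows "hform star iota \<omega> a b = (L a b + cnj (L (star a) (star b))) / 2"
proof -
  have "\<omega> (star (iota x a) * b + b * star (iota x a)) / 2 - \<omega> (star a) * \<omega> b
      = (1/2) * (e (iota x a) b + cnj (e (iota x (star a)) (star b)))" for x
    using symmetrised_e[of "iota x a" b] unfolding iota_star[symmetric] om_iota .
  then have "hform star iota \<omega> a b = infsum (\<lambda>x. (1/2) * (e (iota x a) b + cnj (e (iota x (star a)) (star b)))) UNIV"
    by (simp only: hform_def)
  also have "\<dots> = (1/2) * infsum (\<lambda>x. e (iota x a) b + cnj (e (iota x (star a)) (star b))) UNIV"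
    by (rule infsum_cmult_right')
  also have "infsum (\<lambda>x. e (iota x a) b + cnj (e (iota x (star a)) (star b))) UNIV
      = L a b + infsum (\<lambda>x. cnj (e (iota x (star a)) (star b))) UNIV"
    unfolding L_def by (rule infsum_add) (simp_all add: e_iota_summable assms Ob_star)
  also have "infsum (\<lambda>x. cnj (e (iota x (star a)) (star b))) UNIV = cnj (L (star a) (star b))"
    unfolding L_def by (rule infsum_cnj)
  finally show ?thesis by simp
qed

abbreviation hf :: "'a \<Rightarrow> 'a \<Rightarrow> complex" where "hf \<equiv> hform star iota \<omega>"

sublocale H: psd_form Ob sc hf
proof
  show "hf a (b + c) = hf a b + hf a c" if "a \<in> Ob" "b \<in> Ob" "c \<in> Ob" for a b c
    using that by (simp add: hform_eq Ob_add star_add Ob_star L.B_add_right add_divide_distrib)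
  show "hf a (sc z b) = z * hf a b" if "a \<in> Ob" "b \<in> Ob" for a b z
    using that by (simp add: hform_eq Ob_sc star_sc Ob_star L.B_sc_right algebra_simps)
  show "hf b a = cnj (hf a b)" if "a \<in> Ob" "b \<in> Ob" for a b
    using that L_herm[of b a] L_herm[of "star b" "star a"] by (simp add: hform_eq)
  show "0 \<le> Re (hf a a)" if "a \<in> Ob" for a
    using that L_pos[of a] L_pos[of "star a"] by (simp add: hform_eq Ob_star)
qed (auto simp: Ob_zero Ob_add Ob_sc sc_one sc_neg)

lemma hsn_eq: "hsn star iota \<omega> = H.nrm"
  by (rule ext) (simp add: hsn_def H.nrm_def)

lemma hcauchy_eq: "hcauchy star Oloc iota \<omega> = H.cauchy_seq"
  by (rule ext) (simp add: hcauchy_def H.cauchy_seq_def hsn_eq)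

text \<open>Of two nonnegative numbers each is at most twice their mean. This carries one-sided
  bounds and the Cauchy property between the two norms.\<close>

lemma L_nrm_le:
  assumes "a \<in> Ob"
  shows "L.nrm a \<le> sqrt 2 * H.nrm a" "L.nrm (star a) \<le> sqrt 2 * H.nrm a"
  using assms L_pos[of a] L_pos[of "star a"]
  by (simp_all add: L.nrm_def H.nrm_def hform_eq Ob_star real_sqrt_mult[symmetric])

text \<open>Condition (III) lets one replace \<open>a\<close> by its average over a cube of volume comparable to
  \<open>n ^ D\<close>, and Cauchy--Schwarz with (I) then bounds the limit by the norm of \<open>L\<close>.\<close>

lemma pseudolocal_limit_bounded:
  assumes Q: "pseudolocal star ii Oloc iota \<omega> Q"
  obtains C where "0 \<le> C" "\<And>a. a \<in> Ob \<Longrightarrow> cmod (lim (\<lambda>n. e (Q n) a)) \<le> C * L.nrm a"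
proof -
  define D where "D = CARD('d)"
  have D0: "0 < D" by (simp add: D_def)
  obtain \<gamma> where \<gamma>: "\<gamma> > 0" "\<And>n. n > 0 \<Longrightarrow> Re (e (Q n) (Q n)) \<le> \<gamma> * real n ^ D"
    using Q unfolding pseudolocal_def om_centred_self D_def by blast
  have conv: "convergent (\<lambda>n. e (Q n) a)" if "a \<in> Ob" for a
    using Q that unfolding pseudolocal_def om_centred by blast
  obtain k where k: "0 < k" "k < 1" and
    III: "\<And>a. a \<in> Ob \<Longrightarrow> (\<lambda>n. Max {cmod (e (Q n) (iota x a) - e (Q n) (iota y a))
                      | x y. x \<in> lball (k * real n) \<and> y \<in> lball (k * real n)}) \<longlonglongrightarrow> 0"
    using Q unfolding pseudolocal_def om_centred by blast
  \<comment> \<open>Chosen so that \<open>sqrt (\<gamma> * n ^ D)\<close> is at most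
    \<open>C\<close> times the root of the volume of the averaging cube, which has at least
    \<open>(k * n / D) ^ D\<close> points.\<close>
  define C where "C = sqrt (\<gamma> * (real D / k) ^ D)"
  have C0: "0 \<le> C" using \<gamma>(1) k by (simp add: C_def)
  have "cmod (lim (\<lambda>n. e (Q n) a)) \<le> C * L.nrm a" if a: "a \<in> Ob" for a
  proof -
    define \<epsilon> where "\<epsilon> n = Max {cmod (e (Q n) (iota x a) - e (Q n) (iota y a))
                      | x y. x \<in> lball (k * real n) \<and> y \<in> lball (k * real n)}" for n
    \<comment> \<open>Division by \<open>D\<close> makes the cube fit into the ball of (III), since
      points of \<open>cube j\<close> have length at most \<open>D * j\<close>.\<close>
    define j where "j n = nat \<lfloor>k * real n / real D\<rfloor>" for n :: nat
    define N where "N i = real (card (cube i :: (int^'d) set))" for i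
    define A where "A i = (\<Sum>x\<in>cube i. iota x a)" for i
    have N0: "0 < N i" for i by (simp add: N_def card_cube)
    have eps: "\<epsilon> \<longlonglongrightarrow> 0" unfolding \<epsilon>_def by (rule III[OF a])
    have sub: "x \<in> lball (k * real n)" if x: "x \<in> cube (j n)" for x :: "int^'d" and n
    proof -
      have "real_of_int (ldist x 0) \<le> real (D * j n)"
        using ldist_le_cube[OF x] unfolding D_def by linarith
      also have "\<dots> \<le> real D * (k * real n / real D)"
        unfolding of_nat_mult j_def using k by (intro mult_left_mono of_nat_floor) auto
      also have "\<dots> = k * real n" using D0 by simp
      finally show ?thesis by (simp add: lball_def)
    qed
    have diff: "cmod (e (Q n) a - e (Q n) (iota x a)) \<le> \<epsilon> n" if x: "x \<in> cube (j n)" for x n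
    proof -
      let ?M = "{cmod (e (Q n) (iota x a) - e (Q n) (iota y a)) | x y. x \<in> lball (k * real n) \<and> y \<in> lball (k * real n)}"
      have "?M = (\<lambda>(x, y). cmod (e (Q n) (iota x a) - e (Q n) (iota y a))) ` (lball (k * real n) \<times> lball (k * real n))"
        by auto
      then have fin: "finite ?M" by (simp add: finite_lball)
      have "cmod (e (Q n) (iota 0 a) - e (Q n) (iota x a)) \<in> ?M"
        using sub[OF x] sub[OF zero_in_cube] by blast
      then show ?thesis unfolding \<epsilon>_def using Max_ge[OF fin] by simp
    qed
    have bound: "cmod (e (Q n) a) \<le> \<epsilon> n + C * (E.nrm (A (j n)) / sqrt (N (j n)))" if n: "n > 0" for n
    proof -
      let ?J = "cube (j n) :: (int^'d) set"
      \<comment> \<open>Replaces \<open>a\<close> by its translates: the differences are controlled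
        by (III), the sum of the translates by Cauchy-Schwarz.\<close>
      have "of_real (N (j n)) * e (Q n) a = (\<Sum>x\<in>?J. e (Q n) a - e (Q n) (iota x a)) + e (Q n) (A (j n))"
        by (simp add: sum_subtractf e_sum_right A_def N_def)
      then have "N (j n) * cmod (e (Q n) a)
          = cmod ((\<Sum>x\<in>?J. e (Q n) a - e (Q n) (iota x a)) + e (Q n) (A (j n)))"
        using N0[of "j n"] by (metis norm_mult norm_of_real abs_of_pos)
      also have "\<dots> \<le> cmod (\<Sum>x\<in>?J. e (Q n) a - e (Q n) (iota x a)) + cmod (e (Q n) (A (j n)))"
        by (rule norm_triangle_ineq)
      also have "cmod (\<Sum>x\<in>?J. e (Q n) a - e (Q n) (iota x a)) \<le> (\<Sum>x\<in>?J. \<epsilon> n)"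
        by (intro sum_norm_le diff)
      also have "(\<Sum>x\<in>?J. \<epsilon> n) = N (j n) * \<epsilon> n" by (simp add: N_def)
      also have "cmod (e (Q n) (A (j n))) \<le> E.nrm (Q n) * E.nrm (A (j n))"
        by (rule E.cauchy_schwarz) auto
      also have "E.nrm (Q n) \<le> C * sqrt (N (j n))"
      proof -
        have "k * real n / real D \<le> real (2 * j n + 1)"
          unfolding j_def using k by linarith
        then have "(k * real n / real D) ^ D \<le> real (2 * j n + 1) ^ D"
          using k by (intro power_mono) auto
        then have "(k / real D) ^ D * real n ^ D \<le> N (j n)"
          by (simp add: N_def card_cube D_def power_mult_distrib[symmetric])
        then have "(real D / k) ^ D * ((k / real D) ^ D * real n ^ D) \<le> (real D / k) ^ D * N (j n)"
          using k by (intro mult_left_mono) auto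
        moreover have "(real D / k) ^ D * (k / real D) ^ D = 1"
          using D0 k by (simp add: power_mult_distrib[symmetric])
        ultimately have "real n ^ D \<le> (real D / k) ^ D * N (j n)"
          by (simp add: mult.assoc[symmetric])
        then have "\<gamma> * real n ^ D \<le> \<gamma> * (real D / k) ^ D * N (j n)"
          using \<gamma>(1) by (simp add: mult.assoc)
        then have "Re (e (Q n) (Q n)) \<le> \<gamma> * (real D / k) ^ D * N (j n)"
          using \<gamma>(2)[OF n] by simp
        then show ?thesis unfolding E.nrm_def C_def real_sqrt_mult[symmetric] by (rule real_sqrt_le_mono)
      qed
      finally have "N (j n) * cmod (e (Q n) a) \<le> N (j n) * \<epsilon> n + C * sqrt (N (j n)) * E.nrm (A (j n))"
        by (simp add: mult_right_mono E.nrm_ge_0)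
      also have "\<dots> = N (j n) * (\<epsilon> n + C * (E.nrm (A (j n)) / sqrt (N (j n))))"
        using N0[of "j n"] by (simp add: field_simps)
      finally show ?thesis using N0[of "j n"] by simp
    qed
    have jinf: "filterlim j at_top sequentially"
      unfolding j_def
    proof (rule filterlim_compose[OF filterlim_nat_sequentially filterlim_compose[OF filterlim_floor_sequentially]])
      have "LIM n sequentially. (k / real D) * real n :> at_top"
        using k D0 by (intro filterlim_tendsto_pos_mult_at_top[OF tendsto_const] filterlim_real_sequentially) auto
      then show "LIM n sequentially. k * real n / real D :> at_top" by simp
    qed
    have "(\<lambda>i. sqrt (Re (e (A i) (A i) / of_nat (card (cube i :: (int^'d) set))))) \<longlonglongrightarrow> sqrt (Re (L a a))"
      unfolding A_def by (intro tendsto_real_sqrt tendsto_Re L_average a)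
    moreover have "sqrt (Re (e (A i) (A i) / of_nat (card (cube i :: (int^'d) set)))) = E.nrm (A i) / sqrt (N i)" for i
      by (simp add: E.nrm_def N_def Re_divide_of_nat real_sqrt_divide)
    ultimately have "(\<lambda>i. E.nrm (A i) / sqrt (N i)) \<longlonglongrightarrow> L.nrm a" by (simp add: L.nrm_def)
    from filterlim_compose[OF this jinf]
    have "(\<lambda>n. \<epsilon> n + C * (E.nrm (A (j n)) / sqrt (N (j n)))) \<longlonglongrightarrow> 0 + C * L.nrm a"
      by (intro tendsto_add eps tendsto_mult tendsto_const)
    moreover have "(\<lambda>n. cmod (e (Q n) a)) \<longlonglongrightarrow> cmod (lim (\<lambda>n. e (Q n) a))"
      using conv[OF a] by (intro tendsto_norm) (simp add: convergent_LIMSEQ_iff)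
    ultimately show ?thesis
      using bound by (intro LIMSEQ_le[of _ _ "\<lambda>n. \<epsilon> n + C * (E.nrm (A (j n)) / sqrt (N (j n)))"] exI[of _ 1]) auto
  qed
  then show ?thesis using that C0 by blast
qed

section \<open>Charges as bounded functionals\<close>

lemma pseudolocal_convergent:
  "pseudolocal star ii Oloc iota \<omega> Q \<Longrightarrow> a \<in> Ob \<Longrightarrow> (\<lambda>n. e (Q n) a) \<longlonglongrightarrow> lim (\<lambda>n. e (Q n) a)"
  unfolding pseudolocal_def om_centred by (simp add: convergent_LIMSEQ_iff)

text \<open>The \<open>lim\<close> in \<open>qcharge\<close> is a genuine limit because each of the
  two one-sided limits exists.\<close>

lemma charge_tendsto:
  assumes Q: "pseudolocal star ii Oloc iota \<omega> Q" "pseudolocal star ii Oloc iota \<omega> (\<lambda>n. star (Q n))"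
    and a: "a \<in> Ob"
  shows "(\<lambda>n. (1/2) * (e (Q n) a + cnj (e (star (Q n)) (star a)))) \<longlonglongrightarrow> qcharge star Oloc \<omega> Q a"
proof -
  have "(\<lambda>n. (1/2) * (e (Q n) a + cnj (e (star (Q n)) (star a))))
      \<longlonglongrightarrow> (1/2) * (lim (\<lambda>n. e (Q n) a) + cnj (lim (\<lambda>n. e (star (Q n)) (star a))))"
    by (intro tendsto_mult tendsto_const tendsto_add tendsto_cnj pseudolocal_convergent Q Ob_star a)
  moreover from this have "qcharge star Oloc \<omega> Q a
      = (1/2) * (lim (\<lambda>n. e (Q n) a) + cnj (lim (\<lambda>n. e (star (Q n)) (star a))))"
    using a unfolding qcharge_def symmetrised_e by (simp only: if_True limI)
  ultimately show ?thesis by (simp only:)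
qed

text \<open>The hypotheses of the Riesz argument for the two-sided form; the bound is also the
  continuity asserted in the theorem.\<close>

lemma Qhat_linear_bounded:
  assumes q: "q \<in> Qhat star ii Oloc iota \<omega>"
  shows Qhat_add: "\<And>a b. a \<in> Ob \<Longrightarrow> b \<in> Ob \<Longrightarrow> q (a + b) = q a + q b"
    and Qhat_sc: "\<And>a z. a \<in> Ob \<Longrightarrow> q (sc z a) = z * q a"
    and Qhat_bounded: "\<exists>C. \<forall>a\<in>Ob. cmod (q a) \<le> C * H.nrm a"
proof -
  obtain Q where Q: "pseudolocal star ii Oloc iota \<omega> Q" "pseudolocal star ii Oloc iota \<omega> (\<lambda>n. star (Q n))"
    and qQ: "q = qcharge star Oloc \<omega> Q"
    using q by (auto simp: Qhat_def)
  let ?t = "\<lambda>a n. (1/2) * (e (Q n) a + cnj (e (star (Q n)) (star a)))"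
  have lim: "?t a \<longlonglongrightarrow> q a" if "a \<in> Ob" for a
    unfolding qQ by (rule charge_tendsto[OF Q that])
  show "q (a + b) = q a + q b" if "a \<in> Ob" "b \<in> Ob" for a b
  proof (rule LIMSEQ_unique[OF lim[OF Ob_add[OF that]]])
    have "?t (a + b) = (\<lambda>n. ?t a n + ?t b n)"
      by (rule ext) (simp add: e_add_right star_add algebra_simps)
    then show "?t (a + b) \<longlonglongrightarrow> q a + q b" using tendsto_add[OF lim[OF that(1)] lim[OF that(2)]] by (simp only:)
  qed
  show "q (sc z a) = z * q a" if "a \<in> Ob" for a z
  proof (rule LIMSEQ_unique[OF lim[OF Ob_sc[OF that]]])
    have "?t (sc z a) = (\<lambda>n. z * ?t a n)"
      by (rule ext) (simp add: e_sc_right star_sc algebra_simps)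
    then show "?t (sc z a) \<longlonglongrightarrow> z * q a" using tendsto_mult[OF tendsto_const lim[OF that]] by (simp only:)
  qed
  obtain C1 where C1: "0 \<le> C1" "\<And>a. a \<in> Ob \<Longrightarrow> cmod (lim (\<lambda>n. e (Q n) a)) \<le> C1 * L.nrm a"
    by (rule pseudolocal_limit_bounded[OF Q(1)]) blast
  obtain C2 where C2: "0 \<le> C2" "\<And>a. a \<in> Ob \<Longrightarrow> cmod (lim (\<lambda>n. e (star (Q n)) a)) \<le> C2 * L.nrm a"
    by (rule pseudolocal_limit_bounded[OF Q(2)]) blast
  have "cmod (q a) \<le> (C1 + C2) * sqrt 2 * H.nrm a" if a: "a \<in> Ob" for a
  proof -
    let ?l1 = "lim (\<lambda>n. e (Q n) a)" and ?l2 = "lim (\<lambda>n. e (star (Q n)) (star a))"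
    have "?t a \<longlonglongrightarrow> (1/2) * (?l1 + cnj ?l2)"
      by (intro tendsto_mult tendsto_const tendsto_add tendsto_cnj pseudolocal_convergent Q Ob_star a)
    then have "q a = (1/2) * (?l1 + cnj ?l2)" by (rule LIMSEQ_unique[OF lim[OF a]])
    then have "cmod (q a) = (1/2) * cmod (?l1 + cnj ?l2)" by (simp only: norm_mult) simp
    also have "\<dots> \<le> cmod ?l1 + cmod ?l2"
      using norm_triangle_ineq[of ?l1 "cnj ?l2"] norm_ge_zero[of "?l1 + cnj ?l2"]
      unfolding complex_mod_cnj by linarith
    also have "\<dots> \<le> C1 * L.nrm a + C2 * L.nrm (star a)"
      by (intro add_mono C1(2) C2(2) Ob_star a)
    also have "\<dots> \<le> C1 * (sqrt 2 * H.nrm a) + C2 * (sqrt 2 * H.nrm a)"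
      by (intro add_mono mult_left_mono L_nrm_le a C1 C2)
    also have "\<dots> = (C1 + C2) * sqrt 2 * H.nrm a" by (simp add: algebra_simps)
    finally show ?thesis .
  qed
  then show "\<exists>C. \<forall>a\<in>Ob. cmod (q a) \<le> C * H.nrm a" by blast
qed

lemma Qhat_representation:
  assumes "q \<in> Qhat star ii Oloc iota \<omega>"
  obtains s where "H.cauchy_seq s" "\<And>b. b \<in> Ob \<Longrightarrow> (\<lambda>n. hf (s n) b) \<longlonglongrightarrow> q b"
proof -
  obtain C where C: "\<And>a. a \<in> Ob \<Longrightarrow> cmod (q a) \<le> C * H.nrm a" using Qhat_bounded[OF assms] by auto
  show ?thesis
    by (rule H.riesz_cauchy_seq[OF Qhat_add[OF assms] Qhat_sc[OF assms] C]) (auto intro: that)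
qed

section \<open>Realising a Cauchy sequence by a pseudolocal charge\<close>

text \<open>The half-side \<open>2 * i\<close> leaves a margin: shifted by any \<open>y\<close> in
  \<open>cube i\<close>, the box still covers \<open>cube i\<close>.\<close>

definition boxsum :: "'a \<Rightarrow> nat \<Rightarrow> 'a" where
  "boxsum b i = (\<Sum>x\<in>cube (2 * i). iota x b)"

text \<open>The clauses prepare, in this order, locality of the box sum, the variance bound (I), and
  the limits (II) and (III). The number \<open>m\<close> is at once radius, norm bound and inverse
  accuracy, so that letting it grow reaches every local observable.\<close>

definition adapted :: "'a \<Rightarrow> nat \<Rightarrow> nat \<Rightarrow> bool" where
  "adapted b m i \<longleftrightarrow> b \<in> Oloc (lball (real i)) \<and>
     Re (e (boxsum b i) (boxsum b i)) \<le> real (card (cube (2 * i) :: (int^'d) set)) * (Re (L b b) + 1) \<and>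
     (\<forall>a\<in>Oloc (lball (real m)). norm a \<le> real m \<longrightarrow>
        infsum (\<lambda>z. cmod (e (iota z b) a)) (- cube i) \<le> 1 / real (Suc m))"

lemma star_boxsum: "star (boxsum b i) = boxsum (star b) i"
  by (simp add: boxsum_def star_sum iota_star)

text \<open>For fixed \<open>b\<close> and \<open>m\<close> every clause holds at large scales,
  which is all the diagonal choice needs; no uniformity in \<open>b\<close> is claimed.\<close>

lemma eventually_adapted:
  assumes b: "b \<in> Ob"
  shows "eventually (adapted b m) sequentially"
proof -
  obtain r :: nat where r: "b \<in> Oloc (lball (real r))" by (rule ObE[OF b])
  have 1: "\<forall>\<^sub>F i in sequentially. b \<in> Oloc (lball (real i))"
    using eventually_ge_at_top[of r] by eventually_elim (simp add: Oloc_lball_mono[OF _ r])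
  have "(\<lambda>j. Re (e (\<Sum>x\<in>cube j. iota x b) (\<Sum>y\<in>cube j. iota y b) / of_nat (card (cube j :: (int^'d) set)))) \<longlonglongrightarrow> Re (L b b)"
    by (intro tendsto_Re L_average b)
  from order_tendstoD(2)[OF this, of "Re (L b b) + 1"]
  have "\<forall>\<^sub>F j in sequentially. Re (e (\<Sum>x\<in>cube j. iota x b) (\<Sum>y\<in>cube j. iota y b)) / real (card (cube j :: (int^'d) set)) < Re (L b b) + 1"
    by (simp add: Re_divide_of_nat)
  moreover have "filterlim (\<lambda>i::nat. 2 * i) at_top sequentially"
    by (rule filterlim_subseq) (simp add: strict_mono_def)
  ultimately have "\<forall>\<^sub>F i in sequentially. Re (e (boxsum b i) (boxsum b i)) / real (card (cube (2 * i) :: (int^'d) set)) < Re (L b b) + 1"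
    unfolding boxsum_def by (rule eventually_compose_filterlim)
  then have 2: "\<forall>\<^sub>F i in sequentially. Re (e (boxsum b i) (boxsum b i)) \<le> real (card (cube (2 * i) :: (int^'d) set)) * (Re (L b b) + 1)"
    by eventually_elim (simp add: divide_less_eq card_cube mult.commute)
  have 3: "\<forall>\<^sub>F i in sequentially. \<forall>a\<in>Oloc (lball (real m)). norm a \<le> real m \<longrightarrow>
        infsum (\<lambda>z. cmod (e (iota z b) a)) (- cube i) \<le> 1 / real (Suc m)"
    by (rule cluster_tail_uniform[OF b]) simp
  from 1 2 3 show ?thesis by eventually_elim (simp add: adapted_def)
qed

text \<open>Uniformity in \<open>y\<close> is the point: \<open>y = 0\<close> gives the value of the
  charge, and comparing two values of \<open>y\<close> gives (III).\<close>

lemma adapted_boxsum: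
  assumes ad: "adapted b m i" and a: "a \<in> Oloc (lball (real m))" "norm a \<le> real m" and y: "y \<in> cube i"
  shows "cmod (e (boxsum b i) (iota y a) - L b a) \<le> 1 / real (Suc m)"
proof -
  have b: "b \<in> Ob" using ad ObI[OF finite_lball] by (auto simp: adapted_def)
  have aO: "a \<in> Ob" by (rule ObI[OF finite_lball a(1)])
  let ?g = "\<lambda>z. e (iota z b) a"
  have "e (boxsum b i) (iota y a) = sum ?g ((\<lambda>x. x - y) ` cube (2 * i))"
    by (subst sum.reindex) (auto simp: inj_on_def boxsum_def e_sum_left e_iota_iota)
  then have "cmod (e (boxsum b i) (iota y a) - L b a) = cmod (sum ?g ((\<lambda>x. x - y) ` cube (2 * i)) - infsum ?g UNIV)"
    by (simp add: L_def)
  also have "\<dots> \<le> infsum (\<lambda>z. cmod (?g z)) (- cube i)"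
  proof (intro norm_sum_minus_infsum_le cluster_summable b aO finite_imageI finite_cube subsetI)
    fix z :: "int^'d" assume z: "z \<in> cube i"
    have "- y \<in> cube i" using y by (simp add: cube_def)
    from cube_minus[OF z this] have "z + y \<in> cube (2 * i)" by (simp add: mult_2)
    then show "z \<in> (\<lambda>x. x - y) ` cube (2 * i)" by (intro image_eqI[of _ _ "z + y"]) simp_all
  qed
  also have "\<dots> \<le> 1 / real (Suc m)" using ad a by (simp add: adapted_def)
  finally show ?thesis .
qed

lemma boxsum_in_Oloc:
  assumes b: "b \<in> Oloc (lball (real i))" and n: "4 * CARD('d) * i \<le> n"
  shows "boxsum b i \<in> Oloc (lball (real n))"
  unfolding boxsum_def
proof (rule Oloc_sum[OF finite_lball])
  fix x :: "int^'d" assume x: "x \<in> cube (2 * i)"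
  have "(\<lambda>y. y + x) ` lball (real i) \<subseteq> lball (real n)"
  proof (rule image_subsetI)
    fix y :: "int^'d" assume "y \<in> lball (real i)"
    then have y: "ldist y 0 \<le> int i" by (simp add: lball_def)
    \<comment> \<open>The radius of \<open>b\<close> and the length of the shift add up to at most
      \<open>i + 2 * D * i\<close>, hence at most \<open>3 * D * i\<close>.\<close>
    have "i \<le> CARD('d) * i" by simp
    then have "int i + int (CARD('d) * (2 * i)) \<le> int n" using n by linarith
    then have "ldist (y + x) 0 \<le> int n"
      using ldist_triangle_add[of y x] ldist_le_cube[OF x] y by linarith
    then show "y + x \<in> lball (real n)" by (simp add: lball_def)
  qed
  then show "iota x b \<in> Oloc (lball (real n))"
    using Oloc_iota[OF finite_lball b, of x] Oloc_mono[OF finite_lball] by blast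
qed

text \<open>The scale \<open>i = n div (4 D)\<close> leaves room for \<open>boxsum b i\<close> inside the ball of radius \<open>n\<close>, and
  \<open>m i\<close> grows so slowly that the box looks infinite to the observable \<open>s (m i)\<close>.\<close>

lemma pseudolocal_boxsum:
  fixes s :: "nat \<Rightarrow> 'a" and m :: "nat \<Rightarrow> nat" and G :: "nat \<Rightarrow> bool"
  defines "idx \<equiv> \<lambda>n. n div (4 * CARD('d))"
  defines "Q \<equiv> \<lambda>n. if G (idx n) then boxsum (s (m (idx n))) (idx n) else 0"
  assumes s: "L.cauchy_seq s"
    and m: "filterlim m at_top sequentially"
    and evG: "eventually G sequentially"
    and ad: "\<And>i. G i \<Longrightarrow> adapted (s (m i)) (m i) i"
  shows "pseudolocal star ii Oloc iota \<omega> Q"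
    and "\<And>a. a \<in> Ob \<Longrightarrow> (\<lambda>n. e (Q n) a - L (s (m (idx n))) a) \<longlonglongrightarrow> 0"
    and "filterlim (\<lambda>n. m (idx n)) at_top sequentially"
proof -
  define D where "D = CARD('d)"
  have D1: "1 \<le> D" by (simp add: D_def Suc_leI)
  have sO: "s n \<in> Ob" for n using s by (simp add: L.cauchy_seq_def)
  have idx: "4 * D * idx n \<le> n" for n
    unfolding idx_def D_def by (simp add: mult.commute[of _ "n div _"])
  have idx4: "4 * idx n \<le> n" for n
  proof -
    have "4 * idx n \<le> 4 * D * idx n" using D1 by simp
    then show ?thesis using idx[of n] by linarith
  qed
  have idx_top: "filterlim idx at_top sequentially"
    unfolding filterlim_at_top eventually_sequentially
  proof (intro allI exI impI)
    fix Z n :: nat assume "n \<ge> 4 * D * Z"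
    then have "(4 * D * Z) div (4 * D) \<le> n div (4 * D)" by (rule div_le_mono)
    then show "Z \<le> idx n" using D1 by (simp add: idx_def D_def)
  qed
  show mtop: "filterlim (\<lambda>n. m (idx n)) at_top sequentially"
    by (rule filterlim_compose[OF m idx_top])
  have evGn: "\<forall>\<^sub>F n in sequentially. G (idx n)"
    by (rule eventually_compose_filterlim[OF evG idx_top])
  \<comment> \<open>The estimate behind (II), (III) and the charge: once \<open>m (idx n)\<close>
    exceeds radius and norm of \<open>a\<close>, the box sum is adapted to \<open>a\<close>.\<close>
  have near: "\<forall>\<^sub>F n in sequentially. \<forall>y\<in>cube (idx n).
      cmod (e (Q n) (iota y a) - L (s (m (idx n))) a) \<le> 1 / real (Suc (m (idx n)))" if a: "a \<in> Ob" for a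
  proof -
    obtain r :: nat where r: "a \<in> Oloc (lball (real r))" by (rule ObE[OF a])
    have "\<forall>\<^sub>F n in sequentially. max r (nat \<lceil>norm a\<rceil>) \<le> m (idx n)"
      using mtop unfolding filterlim_at_top by (rule spec)
    with evGn show ?thesis
    proof eventually_elim
      case (elim n)
      have "a \<in> Oloc (lball (real (m (idx n))))" using elim by (intro Oloc_lball_mono[OF _ r]) simp
      moreover have "norm a \<le> real (m (idx n))" using elim by linarith
      ultimately show ?case
        using elim adapted_boxsum[OF ad[OF elim(1)]] by (simp add: Q_def)
    qed
  qed
  have inv0: "(\<lambda>n. 1 / real (Suc (m (idx n)))) \<longlonglongrightarrow> 0"
    using filterlim_compose[OF LIMSEQ_inverse_real_of_nat mtop] by (simp add: inverse_eq_divide)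
  show chg: "(\<lambda>n. e (Q n) a - L (s (m (idx n))) a) \<longlonglongrightarrow> 0" if a: "a \<in> Ob" for a
  proof (rule Lim_null_comparison[OF _ inv0])
    show "\<forall>\<^sub>F n in sequentially. cmod (e (Q n) a - L (s (m (idx n))) a) \<le> 1 / real (Suc (m (idx n)))"
      using near[OF a] by eventually_elim (use zero_in_cube in fastforce)
  qed
  \<comment> \<open>Operator norms along \<open>s\<close> may grow; the variance clause of
    \<open>adapted\<close> involves only \<open>L\<close>-norms, which are bounded for a Cauchy
    sequence.\<close>
  obtain M where M: "0 < M" "\<And>n. L.nrm (s n) \<le> M" by (rule L.cauchy_seq_bounded[OF s]) blast
  show "pseudolocal star ii Oloc iota \<omega> Q"
    unfolding pseudolocal_def om_centred_self
    unfolding om_centred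
  proof (intro conjI)
    \<comment> \<open>Locality and (I) are required at every \<open>n\<close>, not just eventually;
      the value \<open>0\<close> satisfies both where \<open>G\<close> fails.\<close>
    show "\<forall>n. Q n \<in> Oloc (lball (real n))"
    proof
      fix n
      show "Q n \<in> Oloc (lball (real n))"
        using ad[of "idx n"] boxsum_in_Oloc[of "s (m (idx n))" "idx n" n] idx[of n] Oloc_zero[OF finite_lball]
        by (auto simp: Q_def D_def adapted_def)
    qed
    have "Re (e (Q n) (Q n)) \<le> (2 ^ D * (M\<^sup>2 + 1)) * real n ^ CARD('d)" if n: "n > 0" for n
    proof (cases "G (idx n)")
      case True
      have "Re (e (Q n) (Q n)) \<le> real (card (cube (2 * idx n) :: (int^'d) set)) * (Re (L (s (m (idx n))) (s (m (idx n)))) + 1)"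
        using ad[OF True] True by (simp add: adapted_def Q_def)
      also have "\<dots> \<le> (2 * real n) ^ D * (M\<^sup>2 + 1)"
      proof (rule mult_mono)
        \<comment> \<open>Since \<open>n > 0\<close>, the \<open>+ 1\<close> in the side of the cube
          is absorbed by a second \<open>n\<close>.\<close>
        have "real (4 * idx n + 1) \<le> 2 * real n" using idx4[of n] n by linarith
        then show "real (card (cube (2 * idx n) :: (int^'d) set)) \<le> (2 * real n) ^ D"
          unfolding card_cube D_def of_nat_power by (intro power_mono) auto
        show "Re (L (s (m (idx n))) (s (m (idx n)))) + 1 \<le> M\<^sup>2 + 1"
          using M(2)[of "m (idx n)"] L.nrm_ge_0[OF sO] L.nrm_sq[OF sO, of "m (idx n)"]
          by (metis add_right_mono power_mono)
      qed (auto simp: L_pos sO intro: add_nonneg_nonneg)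
      finally show ?thesis by (simp add: D_def power_mult_distrib algebra_simps)
    next
      case False
      then show ?thesis using e_sum_left[of "\<lambda>_. 0" "{}"] by (simp add: Q_def)
    qed
    then show "\<exists>\<gamma>>0. \<forall>n>0. Re (e (Q n) (Q n)) \<le> \<gamma> * real n ^ CARD('d)"
      by (intro exI[of _ "2 ^ D * (M\<^sup>2 + 1)"]) (auto simp: add_nonneg_pos)
    show "\<forall>a\<in>Ob. convergent (\<lambda>n. e (Q n) a)"
    proof (rule ballI)
      fix a assume a: "a \<in> Ob"
      obtain l where "(\<lambda>k. L (s k) a) \<longlonglongrightarrow> l"
        using L.B_cauchy_seq_convergent[OF s a] by (auto simp: convergent_def)
      from tendsto_add[OF chg[OF a] filterlim_compose[OF this mtop]]
      show "convergent (\<lambda>n. e (Q n) a)" by (auto simp: convergent_def)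
    qed
    \<comment> \<open>With this ratio the integer part of \<open>?k * n\<close> is
      \<open>idx n\<close>, so the ball in (III) lies in the cube on which \<open>near\<close>
      holds.\<close>
    let ?k = "1 / real (4 * D)"
    have sub: "lball (?k * real n) \<subseteq> (cube (idx n) :: (int^'d) set)" for n
      using lball_subset_cube[of "?k * real n"] floor_divide_of_nat_eq[where 'a=real, of n "4 * D"]
      by (simp add: idx_def D_def)
    show "\<exists>k. 0 < k \<and> k < 1 \<and> (\<forall>a\<in>Ob. (\<lambda>n. Max {cmod (e (Q n) (iota x a) - e (Q n) (iota y a))
        | x y. x \<in> lball (k * real n) \<and> y \<in> lball (k * real n)}) \<longlonglongrightarrow> 0)"
    proof (intro exI[of _ ?k] conjI ballI)
      show "0 < ?k" "?k < 1" using D1 by auto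
      fix a assume a: "a \<in> Ob"
      let ?M = "\<lambda>n. {cmod (e (Q n) (iota x a) - e (Q n) (iota y a)) | x y. x \<in> lball (?k * real n) \<and> y \<in> lball (?k * real n)}"
      have MaxM: "Max (?M n) \<in> ?M n" for n
      proof (rule Max_in)
        have "?M n = (\<lambda>(x, y). cmod (e (Q n) (iota x a) - e (Q n) (iota y a))) ` (lball (?k * real n) \<times> lball (?k * real n))"
          by auto
        then show "finite (?M n)" by (simp add: finite_lball)
        have "0 \<in> lball (?k * real n)" by (simp add: lball_def ldist_def)
        then show "?M n \<noteq> {}" by blast
      qed
      have two0: "(\<lambda>n. 2 * (1 / real (Suc (m (idx n))))) \<longlonglongrightarrow> 0"
        using tendsto_mult_left[OF inv0, of 2] by simp
      show "(\<lambda>n. Max (?M n)) \<longlonglongrightarrow> 0"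
      proof (rule Lim_null_comparison[OF _ two0])
        show "\<forall>\<^sub>F n in sequentially. norm (Max (?M n)) \<le> 2 * (1 / real (Suc (m (idx n))))"
          using near[OF a]
        proof eventually_elim
          case (elim n)
          obtain x y where xy: "x \<in> lball (?k * real n)" "y \<in> lball (?k * real n)"
            and Mx: "Max (?M n) = cmod (e (Q n) (iota x a) - e (Q n) (iota y a))"
            using MaxM[of n] by blast
          have "cmod (e (Q n) (iota x a) - L (s (m (idx n))) a) \<le> 1 / real (Suc (m (idx n)))"
               "cmod (e (Q n) (iota y a) - L (s (m (idx n))) a) \<le> 1 / real (Suc (m (idx n)))"
            using elim xy sub[of n] by blast+
          then have "cmod (e (Q n) (iota x a) - e (Q n) (iota y a)) \<le> 2 * (1 / real (Suc (m (idx n))))"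
            using norm_triangle_ineq4[of "e (Q n) (iota x a) - L (s (m (idx n))) a" "e (Q n) (iota y a) - L (s (m (idx n))) a"]
            by simp
          then show ?case unfolding Mx by simp
        qed
      qed
    qed
  qed
qed

lemma L_cauchy_seq:
  assumes s: "H.cauchy_seq s"
  shows "L.cauchy_seq s" "L.cauchy_seq (\<lambda>n. star (s n))"
proof -
  have sO: "s n \<in> Ob" for n using s by (simp add: H.cauchy_seq_def)
  have ex: "\<exists>N. \<forall>m\<ge>N. \<forall>n\<ge>N. sqrt 2 * H.nrm (s m - s n) < \<epsilon>" if eps: "0 < \<epsilon>" for \<epsilon>
  proof -
    have "0 < \<epsilon> / sqrt 2" using eps by simp
    then obtain N where "\<And>m n. m \<ge> N \<Longrightarrow> n \<ge> N \<Longrightarrow> H.nrm (s m - s n) < \<epsilon> / sqrt 2"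
      using s unfolding H.cauchy_seq_def by metis
    then show ?thesis by (intro exI[of _ N]) (simp add: field_simps)
  qed
  show "L.cauchy_seq s"
    unfolding L.cauchy_seq_def using ex L_nrm_le(1)[OF H.V_minus[OF sO sO]] sO
    by (meson order_le_less_trans)
  show "L.cauchy_seq (\<lambda>n. star (s n))"
    unfolding L.cauchy_seq_def star_diff[symmetric]
    using ex L_nrm_le(2)[OF H.V_minus[OF sO sO]] Ob_star[OF sO]
    by (meson order_le_less_trans)
qed

text \<open>Surjectivity. The charge of the box sums has the same limit as \<open>hf\<close> along
  the slowed-down sequence \<open>s (m (idx n))\<close>, hence as \<open>hf\<close> along
  \<open>s\<close>.\<close>

lemma cauchy_seq_realisation:
  assumes s: "H.cauchy_seq s"
  obtains q where "q \<in> Qhat star ii Oloc iota \<omega>" "\<And>b. b \<in> Ob \<Longrightarrow> (\<lambda>n. hf (s n) b) \<longlonglongrightarrow> q b"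
proof -
  have sO: "s n \<in> Ob" for n using s by (simp add: H.cauchy_seq_def)
  \<comment> \<open>One diagonal must serve \<open>s\<close> and its adjoint together, because
    \<open>star (Q n)\<close> has to be the box sum of \<open>star (s m)\<close> at the same
    scale.\<close>
  define P where "P m i \<longleftrightarrow> adapted (s m) m i \<and> adapted (star (s m)) m i" for m i
  have "eventually (P m) sequentially" for m
    unfolding P_def by (intro eventually_conj eventually_adapted sO Ob_star)
  then obtain m where m: "filterlim m at_top sequentially" and evP: "\<forall>\<^sub>F i in sequentially. P (m i) i"
    by (rule slow_diagonal)
  define idx where "idx n = n div (4 * CARD('d))" for n :: nat
  define Q where "Q n = (if P (m (idx n)) (idx n) then boxsum (s (m (idx n))) (idx n) else 0)" for n
  have starQ: "star (Q n) = (if P (m (idx n)) (idx n) then boxsum (star (s (m (idx n)))) (idx n) else 0)" for n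
    by (simp add: Q_def star_boxsum star_zero)
  note B1 = pseudolocal_boxsum[OF L_cauchy_seq(1)[OF s] m evP, folded idx_def]
  note B2 = pseudolocal_boxsum[OF L_cauchy_seq(2)[OF s] m evP, folded idx_def]
  have ps1: "pseudolocal star ii Oloc iota \<omega> Q"
    unfolding Q_def by (rule B1(1)) (simp add: P_def)
  have ps2: "pseudolocal star ii Oloc iota \<omega> (\<lambda>n. star (Q n))"
    unfolding starQ by (rule B2(1)) (simp add: P_def)
  have lim1: "(\<lambda>n. e (Q n) a - L (s (m (idx n))) a) \<longlonglongrightarrow> 0" if "a \<in> Ob" for a
    unfolding Q_def by (intro B1(2) that) (simp add: P_def)
  have lim2: "(\<lambda>n. e (star (Q n)) a - L (star (s (m (idx n)))) a) \<longlonglongrightarrow> 0" if "a \<in> Ob" for a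
    unfolding starQ by (intro B2(2) that) (simp add: P_def)
  have mtop: "filterlim (\<lambda>n. m (idx n)) at_top sequentially"
    by (rule B1(3)) (simp add: P_def)
  have "(\<lambda>n. hf (s n) b) \<longlonglongrightarrow> qcharge star Oloc \<omega> Q b" if b: "b \<in> Ob" for b
  proof -
    obtain l where l: "(\<lambda>n. hf (s n) b) \<longlonglongrightarrow> l"
      using H.B_cauchy_seq_convergent[OF s b] by (auto simp: convergent_def)
    let ?d1 = "\<lambda>n. e (Q n) b - L (s (m (idx n))) b"
    let ?d2 = "\<lambda>n. e (star (Q n)) (star b) - L (star (s (m (idx n)))) (star b)"
    have "(\<lambda>n. hf (s (m (idx n))) b + (1/2) * (?d1 n + cnj (?d2 n))) \<longlonglongrightarrow> l + (1/2) * (0 + cnj 0)"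
      by (intro tendsto_add tendsto_mult tendsto_const tendsto_cnj lim1 lim2 b Ob_star filterlim_compose[OF l mtop])
    moreover have "hf (s (m (idx n))) b + (1/2) * (?d1 n + cnj (?d2 n)) = (1/2) * (e (Q n) b + cnj (e (star (Q n)) (star b)))" for n
      by (simp add: hform_eq sO b field_simps)
    ultimately have "(\<lambda>n. (1/2) * (e (Q n) b + cnj (e (star (Q n)) (star b)))) \<longlonglongrightarrow> l"
      by (simp only: complex_cnj_zero add_0_right mult_zero_right)
    then have "qcharge star Oloc \<omega> Q b = l" by (rule LIMSEQ_unique[OF charge_tendsto[OF ps1 ps2 b]])
    then show ?thesis using l by simp
  qed
  moreover have "qcharge star Oloc \<omega> Q \<in> Qhat star ii Oloc iota \<omega>" using ps1 ps2 by (auto simp: Qhat_def)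
  ultimately show ?thesis using that by blast
qed

section \<open>The bijection between charges and classes\<close>

definition repr :: "('a \<Rightarrow> complex) \<Rightarrow> (nat \<Rightarrow> 'a) set" where
  "repr q = {t. H.cauchy_seq t \<and> (\<forall>b\<in>Ob. (\<lambda>n. hf (t n) b) \<longlonglongrightarrow> q b)}"

text \<open>Collecting all representing sequences avoids a choice and yields a full equivalence
  class: equal weak limits force equivalence by uniqueness, and equivalent sequences have equal weak
  limits by Cauchy-Schwarz.\<close>

lemma repr_eq_class:
  assumes s: "s \<in> repr q"
  shows "repr q = {t. hcauchy star Oloc iota \<omega> t \<and> hequiv star iota \<omega> s t}"
proof (intro equalityI subsetI; clarify)
  have sc: "H.cauchy_seq s" and sl: "\<And>b. b \<in> Ob \<Longrightarrow> (\<lambda>n. hf (s n) b) \<longlonglongrightarrow> q b"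
    using s by (auto simp: repr_def)
  have sO: "s n \<in> Ob" for n using sc by (simp add: H.cauchy_seq_def)
  fix t
  {
    assume "t \<in> repr q"
    then have tc: "H.cauchy_seq t" and tl: "\<And>b. b \<in> Ob \<Longrightarrow> (\<lambda>n. hf (t n) b) \<longlonglongrightarrow> q b"
      by (auto simp: repr_def)
    have tO: "t n \<in> Ob" for n using tc by (simp add: H.cauchy_seq_def)
    have "(\<lambda>n. hf (s n - t n) b) \<longlonglongrightarrow> 0" if b: "b \<in> Ob" for b
      using tendsto_diff[OF sl[OF b] tl[OF b]] by (simp add: H.B_minus_left sO tO b)
    then have "(\<lambda>n. H.nrm (s n - t n)) \<longlonglongrightarrow> 0"
      by (rule H.cauchy_seq_weak_limit_unique[OF H.cauchy_seq_minus[OF sc tc]])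
    then show "hcauchy star Oloc iota \<omega> t \<and> hequiv star iota \<omega> s t"
      using tc by (simp add: hcauchy_eq hequiv_def hsn_eq)
  next
    assume "hcauchy star Oloc iota \<omega> t" "hequiv star iota \<omega> s t"
    then have tc: "H.cauchy_seq t" and eq: "(\<lambda>n. H.nrm (s n - t n)) \<longlonglongrightarrow> 0"
      by (simp_all add: hcauchy_eq hequiv_def hsn_eq)
    have tO: "t n \<in> Ob" for n using tc by (simp add: H.cauchy_seq_def)
    have "(\<lambda>n. hf (t n) b) \<longlonglongrightarrow> q b" if b: "b \<in> Ob" for b
    proof -
      have "(\<lambda>n. hf (s n - t n) b) \<longlonglongrightarrow> 0" by (rule H.B_tendsto_0[OF H.V_minus[OF sO tO] eq b])
      from tendsto_diff[OF sl[OF b] this] show ?thesis by (simp add: H.B_minus_left sO tO b)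
    qed
    then show "t \<in> repr q" using tc by (simp add: repr_def)
  }
qed

lemma repr_nonempty: "q \<in> Qhat star ii Oloc iota \<omega> \<Longrightarrow> \<exists>s. s \<in> repr q"
  by (erule Qhat_representation) (auto simp: repr_def)

lemma bij_betw_repr: "bij_betw repr (Qhat star ii Oloc iota \<omega>) (Hhat star Oloc iota \<omega>)"
  unfolding bij_betw_def
proof (intro conjI inj_onI equalityI subsetI)
  fix q q' assume q: "q \<in> Qhat star ii Oloc iota \<omega>" and q': "q' \<in> Qhat star ii Oloc iota \<omega>"
    and eq: "repr q = repr q'"
  obtain s where s: "s \<in> repr q" using repr_nonempty[OF q] by blast
  show "q = q'"
  proof
    fix a
    show "q a = q' a"
    proof (cases "a \<in> Ob")
      case True
      then have "(\<lambda>n. hf (s n) a) \<longlonglongrightarrow> q a" "(\<lambda>n. hf (s n) a) \<longlonglongrightarrow> q' a"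
        using s eq by (auto simp: repr_def)
      then show ?thesis by (rule LIMSEQ_unique)
    next
      \<comment> \<open>Outside the local observables every charge is \<open>0\<close> by
        convention, so charges agreeing on \<open>Ob\<close> are equal as functions.\<close>
      case False
      then show ?thesis using q q' by (auto simp: Qhat_def qcharge_def)
    qed
  qed
next
  fix h assume "h \<in> repr ` Qhat star ii Oloc iota \<omega>"
  then obtain q where q: "q \<in> Qhat star ii Oloc iota \<omega>" and h: "h = repr q" by blast
  obtain s where s: "s \<in> repr q" using repr_nonempty[OF q] by blast
  then have "hcauchy star Oloc iota \<omega> s" by (simp add: repr_def hcauchy_eq)
  then show "h \<in> Hhat star Oloc iota \<omega>"
    unfolding Hhat_def h repr_eq_class[OF s] by blast
next
  fix h assume "h \<in> Hhat star Oloc iota \<omega>"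
  then obtain s where s: "H.cauchy_seq s"
    and h: "h = {t. hcauchy star Oloc iota \<omega> t \<and> hequiv star iota \<omega> s t}"
    unfolding Hhat_def hcauchy_eq by blast
  obtain q where q: "q \<in> Qhat star ii Oloc iota \<omega>" "\<And>b. b \<in> Ob \<Longrightarrow> (\<lambda>n. hf (s n) b) \<longlonglongrightarrow> q b"
    by (rule cauchy_seq_realisation[OF s]) blast
  then have "s \<in> repr q" using s by (simp add: repr_def)
  then have "h = repr q" using h repr_eq_class by simp
  then show "h \<in> repr ` Qhat star ii Oloc iota \<omega>" using q by blast
qed

text \<open>The representative picked by \<open>SOME\<close> is immaterial, as all members of the
  class have the same limit against \<open>a\<close>.\<close>

lemma hpair_repr:
  assumes "q \<in> Qhat star ii Oloc iota \<omega>" "a \<in> Ob"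
  shows "q a = hpair star iota \<omega> (repr q) a"
proof -
  have "(SOME s. s \<in> repr q) \<in> repr q" using repr_nonempty[OF assms(1)] by (rule someI_ex)
  then have "(\<lambda>n. hf ((SOME s. s \<in> repr q) n) a) \<longlonglongrightarrow> q a" using assms(2) by (auto simp: repr_def)
  then show ?thesis unfolding hpair_def by (simp add: limI)
qed

end

theorem theorem5p8:
  fixes star :: "'a::{real_normed_algebra_1,banach} \<Rightarrow> 'a"
    and ii :: 'a
    and Oloc :: "(int^'d) set \<Rightarrow> 'a set"
    and iota :: "int^'d \<Rightarrow> 'a \<Rightarrow> 'a"
    and \<omega> :: "'a \<Rightarrow> complex"
  assumes "clustering_state star ii Oloc iota \<omega>"
  shows "\<exists>D. bij_betw D (Qhat star ii Oloc iota \<omega>) (Hhat star Oloc iota \<omega>) \<and>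
             (\<forall>q\<in>Qhat star ii Oloc iota \<omega>. \<forall>a\<in>Obs Oloc.
                 q a = hpair star iota \<omega> (D q) a) \<and>
             (\<forall>q\<in>Qhat star ii Oloc iota \<omega>. \<exists>C. \<forall>a\<in>Obs Oloc.
                 cmod (q a) \<le> C * hsn star iota \<omega> a)"
proof -
  interpret clustering star ii Oloc iota \<omega> by unfold_locales (rule assms)
  show ?thesis
    unfolding hsn_eq using bij_betw_repr hpair_repr Qhat_bounded by blast
qed

end
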